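(* Assume that: (i) for every $i\in\{1,\dots,N\}$ the function $f_i:\mathbb{R}^d\to\mathbb{R}$ is differentiable and strongly convex with coefficient $\alpha>0$; (ii) for every $i$ the gradient $\nabla f_i$ is Lipschitz continuous with constant $\beta>0$; (iii) the graph $\mathcal{G}$ is undirected and connected. Let $x^\star\in\mathbb{R}^d$ be the unique minimizer of $\sum_{i=1}^N f_i$. Consider the Asynchronous Triggered Gradient Tracking algorithm with parameters $\lambda>0$ and $\nu>0$ (defined in the context), and pick any initial condition $x(0),z(0)\in\mathbb{R}^{Nd}$, $\xi(0)=\mathrm{col}(\xi_1(0),\dots,\xi_N(0))\in\mathbb{R}^N$ such that $\sum_{i=1}^N z_i(0)=0$ and $\xi_i(0)\neq0$ for all $i\in\{1,\dots,N\}$. Then there exist $\lambda^\star>0$, $\nu^\star>0$, $a_5>0$ and $a_6>0$ such that for any $\lambda\in(0,\lambda^\star)$ and any $\nu>\nu^\star$ it holds $$\|x_i(t)-x^\star\|\le a_5\exp(-a_6 t)\qquad\text{for all } t\ge0\text{ and all } i\in\{1,\dots,N\}.$$ Moreover, the algorithm does not exhibit the Zeno behavior, i.e., for no agent $i$ does the sequence of triggering times $\{t_i^{k_i}\}_{k_i\in\mathbb{N}}$ consist of infinitely many instants converging to a finite limit $t_i^\infty$.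
   Context: $N$ agents communicate over a graph $\mathcal{G}=(\{1,\dots,N\},\mathcal{E})$. The set of neighbors of agent $i$ is $\mathcal{N}_i=\{j : (i,j)\in\mathcal{E}\}$, which includes $i$ itself (self-loops). $\mathcal{W}=[w_{ij}]\in\mathbb{R}^{N\times N}$ is a symmetric weighted adjacency matrix with $w_{ij}>0$ if $(i,j)\in\mathcal{E}$ and $w_{ij}=0$ otherwise. $\mathrm{col}$ denotes vertical concatenation and $\|\cdot\|$ the Euclidean norm. Asynchronous Triggered Gradient Tracking. Each agent $i$ has continuous states $x_i(t),z_i(t)\in\mathbb{R}^d$ and $\xi_i(t)\in\mathbb{R}$, and a sequence of triggering times $0=t_i^0<t_i^1<t_i^2<\cdots$ at which it sends $x_i$, $z_i$ and $\nabla f_i(x_i)$ to its neighbors; write $x=\mathrm{col}(x_1,\dots,x_N)$, $z=\mathrm{col}(z_1,\dots,z_N)$. At time $t$ let $\tau_i(t)$ be the most recent triggering time of agent $i$, i.e. the largest $t_i^{k_i}\le t$, and set $\hat x_i(t)=x_i(\tau_i(t))$, $\hat z_i(t)=z_i(\tau_i(t))$, $\hat g_i(t)=\nabla f_i(x_i(\tau_i(t)))$ (these are constant between consecutive triggering times of the network). The dynamics are $$\dot x_i(t) = -\sum_{j\in\mathcal{N}_i} w_{ij}\big(\hat x_i(t)-\hat x_j(t)\big)-z_i(t)-\nabla f_i(x_i(t)),$$ $$\dot z_i(t) = -\sum_{j\in\mathcal{N}_i} w_{ij}\big(\hat z_i(t)-\hat z_j(t)\big)-\sum_{j\in\mathcal{N}_i}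 w_{ij}\big(\hat g_i(t)-\hat g_j(t)\big),\qquad \dot\xi_i(t)=-\nu\,\xi_i(t).$$ The next triggering time of agent $i$ is $$t_i^{k_i+1}=\inf\big\{t>t_i^{k_i} : \|e_i(t)\|>\lambda\|h_i(t)\|+|\xi_i(t)|\big\},$$ where $h_i(t)=z_i(t)+\nabla f_i(x_i(t))$ and $e_i(t)=\mathrm{col}\big(x_i(t)-x_i(t_i^{k_i}),\,z_i(t)-z_i(t_i^{k_i}),\,\nabla f_i(x_i(t))-\nabla f_i(x_i(t_i^{k_i}))\big)$ (if the set is empty, agent $i$ does not trigger again). *)

theory Defs
  imports "HOL-Analysis.Analysis"
begin

definition grad :: "('a::real_inner \<Rightarrow> real) \<Rightarrow> 'a \<Rightarrow> 'a" where
  "grad \<phi> x = (THE D. GDERIV \<phi> x :> D)"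

definition strongly_convex :: "real \<Rightarrow> ('a::real_inner \<Rightarrow> real) \<Rightarrow> bool" where
  "strongly_convex \<alpha> \<phi> \<longleftrightarrow>
     (\<forall>x y. \<forall>u\<in>{0..1}. \<phi> (u *\<^sub>R x + (1 - u) *\<^sub>R y)
        \<le> u * \<phi> x + (1 - u) * \<phi> y - \<alpha> / 2 * u * (1 - u) * (norm (x - y))\<^sup>2)"

definition weighted_adjacency :: "('n \<times> 'n) set \<Rightarrow> real^'n^'n \<Rightarrow> bool" where
  "weighted_adjacency E W \<longleftrightarrow>
     transpose W = W \<and> (\<forall>i j. if (i, j) \<in> E then W $ i $ j > 0 else W $ i $ j = 0)"

definition connected_graph :: "('n \<times> 'n) set \<Rightarrow> bool" where
  "connected_graph E \<longleftrightarrow> (\<forall>i j. (i, j) \<in> E\<^sup>*)"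

definition neighbors :: "('n \<times> 'n) set \<Rightarrow> 'n \<Rightarrow> 'n set" where
  "neighbors E i = {j. (i, j) \<in> E}"

text \<open>
  The differential equations on the time set \<open>I\<close>, when the most recently broadcast
  information of each agent \<open>i\<close> is that of the instant \<open>\<tau> i\<close> (constant on \<open>I\<close>).
\<close>
definition held_dynamics ::
  "('n::finite \<times> 'n) set \<Rightarrow> real^'n^'n \<Rightarrow> ('n \<Rightarrow> real^'d \<Rightarrow> real) \<Rightarrow> ('n \<Rightarrow> real)
   \<Rightarrow> ('n \<Rightarrow> real \<Rightarrow> real^'d) \<Rightarrow> ('n \<Rightarrow> real \<Rightarrow> real^'d) \<Rightarrow> real set \<Rightarrow> bool" where
  "held_dynamics E W f \<tau> x z I \<longleftrightarrow>
     (let xh = (\<lambda>i. x i (\<tau> i)); zh = (\<lambda>i. z i (\<tau> i)); gh = (\<lambda>i. grad (f i) (x i (\<tau> i)))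
      in \<forall>i. \<forall>t\<in>I.
        (x i has_vector_derivative
           - (\<Sum>j\<in>neighbors E i. (W $ i $ j) *\<^sub>R (xh i - xh j)) - z i t - grad (f i) (x i t))
           (at t within I) \<and>
        (z i has_vector_derivative
           - (\<Sum>j\<in>neighbors E i. (W $ i $ j) *\<^sub>R (zh i - zh j))
           - (\<Sum>j\<in>neighbors E i. (W $ i $ j) *\<^sub>R (gh i - gh j)))
           (at t within I))"

text \<open>
  \<open>norm\<close> on nested pairs is the Euclidean norm of the concatenated vector.
\<close>
definition trigger_condition ::
  "('n \<Rightarrow> real^'d \<Rightarrow> real) \<Rightarrow> real \<Rightarrow> ('n \<Rightarrow> real \<Rightarrow> real^'d) \<Rightarrow> ('n \<Rightarrow> real \<Rightarrow> real^'d)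
   \<Rightarrow> ('n \<Rightarrow> real \<Rightarrow> real) \<Rightarrow> 'n \<Rightarrow> real \<Rightarrow> real \<Rightarrow> bool" where
  "trigger_condition f lam x z \<xi> i \<tau> t \<longleftrightarrow>
     norm (x i t - x i \<tau>, z i t - z i \<tau>, grad (f i) (x i t) - grad (f i) (x i \<tau>))
       > lam * norm (z i t + grad (f i) (x i t)) + \<bar>\<xi> i t\<bar>"

text \<open>The value is \<open>\<infinity>\<close> if the set is empty.\<close>
definition next_trigger ::
  "('n \<Rightarrow> real^'d \<Rightarrow> real) \<Rightarrow> real \<Rightarrow> ('n \<Rightarrow> real \<Rightarrow> real^'d) \<Rightarrow> ('n \<Rightarrow> real \<Rightarrow> real^'d)
   \<Rightarrow> ('n \<Rightarrow> real \<Rightarrow> real) \<Rightarrow> 'n \<Rightarrow> real \<Rightarrow> ereal" where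
  "next_trigger f lam x z \<xi> i \<tau> =
     Inf (ereal ` {t. t > \<tau> \<and> trigger_condition f lam x z \<xi> i \<tau> t})"

text \<open>
  Executions of the algorithm. The state \<open>(x, z, \<xi>)\<close> consists of functions of time and
  \<open>T i\<close> is the set of all triggering times of agent \<open>i\<close>.

  The infimum that defines the next triggering time of agent \<open>i\<close> concerns the evolution in
  which agent \<open>i\<close> keeps its last broadcast; read along the trajectory obtained
  \<^emph>\<open>after\<close> the broadcast it would be circular. Hence an execution is built from network
  events \<open>s 0 \<le> s 1 \<le> \<dots>\<close>: the pair \<open>X m, Z m\<close> is the actual trajectory up to
  time \<open>s m\<close>, continued on \<open>[s m, \<infinity>)\<close> with all broadcasts held at those of the instants
  \<open>\<tau> m i\<close>. Along it the next triggering time of every agent is computed; the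
  earliest one is the next network event, and exactly the agents attaining it trigger.
  Events may coincide in time (a broadcast may make the condition of another agent hold
  immediately afterwards). If no agent triggers again, then \<open>s\<close> is \<open>\<infinity>\<close> from there on.

  Nothing forces \<open>s\<close> to be unbounded: if triggering times accumulated at a finite instant,
  \<open>x\<close> and \<open>z\<close> would be determined only before that instant.
\<close>
definition atgt_execution ::
  "('n::finite \<times> 'n) set \<Rightarrow> real^'n^'n \<Rightarrow> ('n \<Rightarrow> real^'d \<Rightarrow> real) \<Rightarrow> real \<Rightarrow> real
   \<Rightarrow> ('n \<Rightarrow> real \<Rightarrow> real^'d) \<Rightarrow> ('n \<Rightarrow> real \<Rightarrow> real^'d) \<Rightarrow> ('n \<Rightarrow> real \<Rightarrow> real)
   \<Rightarrow> ('n \<Rightarrow> real set) \<Rightarrow> bool" where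
  "atgt_execution E W f lam nu x z \<xi> T \<longleftrightarrow>
     (\<forall>i. \<forall>t\<ge>0. (\<xi> i has_real_derivative - nu * \<xi> i t) (at t within {0..})) \<and>
     (\<exists>(s :: nat \<Rightarrow> ereal) (\<tau> :: nat \<Rightarrow> 'n \<Rightarrow> real) X Z.
        s 0 = 0 \<and> (\<forall>i. \<tau> 0 i = 0) \<and>
        (\<forall>m. held_dynamics E W f (\<tau> m) (X m) (Z m) {t. s m \<le> ereal t}) \<and>
        (\<forall>m. s (Suc m) = (INF i. next_trigger f lam (X m) (Z m) \<xi> i (\<tau> m i))) \<and>
        (\<forall>m i. \<tau> (Suc m) i =
           (if s (Suc m) < \<infinity> \<and> next_trigger f lam (X m) (Z m) \<xi> i (\<tau> m i) = s (Suc m)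
            then real_of_ereal (s (Suc m)) else \<tau> m i)) \<and>
        (\<forall>m i t. 0 \<le> t \<longrightarrow> ereal t \<le> s (Suc m) \<longrightarrow>
           X (Suc m) i t = X m i t \<and> Z (Suc m) i t = Z m i t) \<and>
        (\<forall>m i t. 0 \<le> t \<longrightarrow> ereal t \<le> s (Suc m) \<longrightarrow>
           x i t = X m i t \<and> z i t = Z m i t) \<and>
        (\<forall>i. T i = range (\<lambda>m. \<tau> m i)))"

definition zeno :: "real set \<Rightarrow> bool" where
  "zeno T \<longleftrightarrow> (\<exists>t :: nat \<Rightarrow> real. strict_mono t \<and> range t = T \<and> convergent t)"

end

theory Submission
  imports Defs
begin

text \<open>
  Write \<open>q = z + \<nabla>f(1 x*) - L (x - 1 x*)\<close>, where \<open>L\<close> is the graph Laplacian. Without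
  sampling errors the closed loop becomes \<open>x' = - 2 L x - q - (\<nabla>f(x) - \<nabla>f(1 x*))\<close> and
  \<open>q' = L\<^sup>2 x\<close> (with \<open>x\<close> centred at \<open>1 x*\<close>), so in terms of \<open>p = L\<^sup>+ q\<close> the energy
  \<open>(\<bar>x\<bar>\<^sup>2 + \<bar>p\<bar>\<^sup>2) / 2\<close> is dissipated by strong convexity, and the cross term
  \<open>\<epsilon> x \<bullet> L p\<close> makes the decay exponential. The trigger rule bounds the sampling errors by
  \<open>\<lambda> \<bar>h\<bar> + \<bar>\<xi>\<bar>\<close>: the first part is absorbed for small \<open>\<lambda>\<close>, the second decays exponentially.
  The resulting bound makes the trajectories Lipschitz uniformly over all events; at an event the
  error of the triggering agent is at least \<open>\<bar>\<xi>\<^sub>i\<bar>\<close>, which is bounded below on finite time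
  intervals, so events cannot accumulate.
\<close>

section \<open>Gradients of strongly convex functions\<close>

text \<open>Two obstacles shape the argument. Trajectories are known on
  [0, \<open>s (Suc m)\<close>] for each m, while unboundedness of \<open>s\<close> is itself a
  claim; so the state estimates are proved by induction over events with constants independent of m,
  and the decay bound reaches every time once they have forced \<open>s\<close> to be unbounded.
  Moreover, several events may share one instant, so gaps between consecutive event times have no
  positive lower bound; progress is measured by the sum over agents of the last broadcast times.

  Passing from q to p makes the coupling skew: x \<bullet> L p from the x equation cancels p
  \<bullet> L x from the p equation, L being self-adjoint. The preimage p exists because q has zero
  agent sum: z keeps its zero sum and the gradients at the minimizer sum to zero.

  The decay rate c of the energy also serves as threshold for nu: for nu \<ge> c the squared part of
  the error due to \<xi> decays at least like exp(-2ct) and stays integrable against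
  exp(ct).\<close>

lemma GDERIV_grad:
  fixes \<phi> :: "'a::euclidean_space \<Rightarrow> real"
  assumes "\<phi> differentiable at x"
  shows "GDERIV \<phi> x :> grad \<phi> x"
proof -
  obtain D where D: "(\<phi> has_derivative D) (at x)"
    using assms unfolding differentiable_def by blast
  \<comment> \<open>Riesz representative of the derivative; together with uniqueness of derivatives
    it makes the definite description in \<open>grad\<close> well defined.\<close>
  define g where "g = (\<Sum>b\<in>Basis. D b *\<^sub>R b)"
  have lin: "linear D"
    using D has_derivative_linear by blast
  have "D = (\<lambda>h. h \<bullet> g)"
  proof
    fix h
    have "D h = D (\<Sum>b\<in>Basis. (h \<bullet> b) *\<^sub>R b)"
      by (simp add: euclidean_representation)
    also have "\<dots> = (\<Sum>b\<in>Basis. (h \<bullet> b) * D b)"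
      using lin by (simp add: linear_sum linear_scale)
    finally show "D h = h \<bullet> g"
      by (simp add: g_def inner_sum_right mult.commute)
  qed
  then have g: "GDERIV \<phi> x :> g"
    using D by (simp add: gderiv_def)
  have "D' = g" if "GDERIV \<phi> x :> D'" for D'
  proof -
    have "(\<lambda>h. h \<bullet> D') = (\<lambda>h. h \<bullet> g)"
      using that g has_derivative_unique unfolding gderiv_def by blast
    then have "h \<bullet> D' = h \<bullet> g" for h
      by (rule fun_cong)
    then show ?thesis
      using vector_eq_ldot by blast
  qed
  with g show ?thesis
    unfolding grad_def by (rule theI)
qed

lemma strongly_convex_grad_ineq:
  fixes \<phi> :: "'a::euclidean_space \<Rightarrow> real"
  assumes sc: "strongly_convex \<alpha> \<phi>" and diff: "\<phi> differentiable at x"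
  shows "\<phi> x + grad \<phi> x \<bullet> (y - x) + \<alpha> / 2 * (norm (y - x))\<^sup>2 \<le> \<phi> y"
proof -
  define \<psi> where "\<psi> u = \<phi> (x + u *\<^sub>R (y - x))" for u :: real
  \<comment> \<open>Keeping the quadratic term inside \<open>r\<close> gives
    \<open>r u \<le> \<phi> y - \<phi> x\<close> for every u in (0,1); the claim is the limit from
    the right at 0.\<close>
  define r where "r u = (\<psi> u - \<psi> 0) / u + \<alpha> / 2 * (1 - u) * (norm (y - x))\<^sup>2" for u :: real
  have gd: "(\<phi> has_derivative (\<lambda>h. h \<bullet> grad \<phi> x)) (at (x + 0 *\<^sub>R (y - x)))"
    using GDERIV_grad[OF diff] by (simp add: gderiv_def)
  have "((\<lambda>u. x + u *\<^sub>R (y - x)) has_derivative (\<lambda>u. u *\<^sub>R (y - x))) (at 0)"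
    by (auto intro!: derivative_eq_intros)
  then have "(\<psi> has_derivative (\<lambda>u. (u *\<^sub>R (y - x)) \<bullet> grad \<phi> x)) (at 0)"
    unfolding \<psi>_def by (rule has_derivative_compose[where g = \<phi>]) (rule gd)
  then have "(\<psi> has_real_derivative (y - x) \<bullet> grad \<phi> x) (at 0)"
    by (rule has_derivative_imp_has_field_derivative) simp
  then have quot: "((\<lambda>u. (\<psi> u - \<psi> 0) / u) \<longlongrightarrow> (y - x) \<bullet> grad \<phi> x) (at_right 0)"
    unfolding DERIV_def by (simp add: filterlim_at_split)
  have "((\<lambda>u. \<alpha> / 2 * (1 - u) * (norm (y - x))\<^sup>2) \<longlongrightarrow> \<alpha> / 2 * (1 - 0) * (norm (y - x))\<^sup>2) (at_right 0)"
    by (intro tendsto_intros)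
  from tendsto_add[OF quot this]
  have "(r \<longlongrightarrow> (y - x) \<bullet> grad \<phi> x + \<alpha> / 2 * (norm (y - x))\<^sup>2) (at_right 0)"
    unfolding r_def by simp
  moreover have "\<forall>\<^sub>F u in at_right 0. r u \<le> \<phi> y - \<phi> x"
  proof -
    have "r u \<le> \<phi> y - \<phi> x" if "0 < u" "u < 1" for u
    proof -
      have "x + u *\<^sub>R (y - x) = u *\<^sub>R y + (1 - u) *\<^sub>R x"
        by (simp add: algebra_simps)
      then have "\<psi> u \<le> u * \<phi> y + (1 - u) * \<phi> x - \<alpha> / 2 * u * (1 - u) * (norm (y - x))\<^sup>2"
        using sc that unfolding strongly_convex_def \<psi>_def by auto
      then have "\<psi> u - \<psi> 0 \<le> u * (\<phi> y - \<phi> x - \<alpha> / 2 * (1 - u) * (norm (y - x))\<^sup>2)"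
        by (simp add: \<psi>_def algebra_simps)
      then have "(\<psi> u - \<psi> 0) / u \<le> \<phi> y - \<phi> x - \<alpha> / 2 * (1 - u) * (norm (y - x))\<^sup>2"
        using that by (simp add: pos_divide_le_eq mult.commute)
      then show ?thesis
        unfolding r_def by linarith
    qed
    then show ?thesis
      by (auto simp: eventually_at_right_field intro!: exI[of _ 1])
  qed
  ultimately have "(y - x) \<bullet> grad \<phi> x + \<alpha> / 2 * (norm (y - x))\<^sup>2 \<le> \<phi> y - \<phi> x"
    by (rule tendsto_upperbound) simp
  then show ?thesis
    by (simp add: inner_commute)
qed

text \<open>Adding the first-order inequalities at x and at y cancels the function values.\<close>

lemma strongly_convex_grad_mono:
  fixes \<phi> :: "'a::euclidean_space \<Rightarrow> real"
  assumes "strongly_convex \<alpha> \<phi>" and "\<And>x. \<phi> differentiable at x"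
  shows "\<alpha> * (norm (x - y))\<^sup>2 \<le> (grad \<phi> x - grad \<phi> y) \<bullet> (x - y)"
  using strongly_convex_grad_ineq[OF assms(1) assms(2)[of x], of y]
    strongly_convex_grad_ineq[OF assms(1) assms(2)[of y], of x]
  by (simp add: inner_diff_left inner_diff_right norm_minus_commute)

lemma sum_grad_eq_0_at_minimum:
  fixes f :: "'n::finite \<Rightarrow> 'a::euclidean_space \<Rightarrow> real"
  assumes "\<And>i. f i differentiable at x"
    and min: "\<And>y. (\<Sum>i\<in>UNIV. f i x) \<le> (\<Sum>i\<in>UNIV. f i y)"
  shows "(\<Sum>i\<in>UNIV. grad (f i) x) = 0"
proof -
  have "((\<lambda>y. \<Sum>i\<in>UNIV. f i y) has_derivative (\<lambda>h. \<Sum>i\<in>UNIV. h \<bullet> grad (f i) x)) (at x)"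
    using GDERIV_grad[OF assms(1)] by (intro has_derivative_sum) (simp add: gderiv_def)
  from differential_zero_maxmin[OF _ _ this, of UNIV] min
  have "h \<bullet> (\<Sum>i\<in>UNIV. grad (f i) x) = 0" for h
    by (simp add: inner_sum_right fun_eq_iff)
  from this[of "\<Sum>i\<in>UNIV. grad (f i) x"] show ?thesis
    by simp
qed

section \<open>The graph Laplacian\<close>

text \<open>The sum may run over all agents because weights vanish off the graph, and self-loops
  contribute zero. Entries are vectors, so this is the Laplacian matrix acting blockwise.\<close>

definition laplacian :: "real^'n^'n \<Rightarrow> 'a::real_inner^'n \<Rightarrow> 'a^'n" where
  "laplacian W x = (\<chi> i. \<Sum>j\<in>UNIV. W $ i $ j *\<^sub>R (x $ i - x $ j))"

text \<open>Orthogonal projection onto the consensus vectors, which form the kernel of the Laplacian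
  of a connected graph.\<close>

definition average :: "'a::real_vector^'n \<Rightarrow> 'a^'n" where
  "average x = (\<chi> i. (1 / real CARD('n)) *\<^sub>R (\<Sum>j\<in>UNIV. x $ j))"

lemma linear_laplacian: "linear (laplacian W)"
  by (rule linearI)
    (simp_all add: laplacian_def vec_eq_iff scaleR_sum_right sum.distrib[symmetric] algebra_simps)

lemma linear_average: "linear (average :: 'a::real_vector^'n \<Rightarrow> 'a^'n)"
  by (rule linearI)
    (simp_all add: average_def vec_eq_iff scaleR_sum_right sum.distrib algebra_simps)

context
  fixes W :: "real^'n^'n"
  assumes sym: "transpose W = W"
begin

lemma weight_commute: "W $ i $ j = W $ j $ i"
  using sym by (metis transpose_def vec_lambda_beta)

text \<open>Exchanging the summation indices and using symmetry of the weights gives a second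
  expression for the same number; averaging both yields the Dirichlet form. Self-adjointness,
  nonnegativity, the kernel and the zero agent sum are all read off from it.\<close>

lemma inner_laplacian:
  fixes x y :: "'a::real_inner^'n"
  shows "x \<bullet> laplacian W y = (\<Sum>i\<in>UNIV. \<Sum>j\<in>UNIV. W $ i $ j * ((x $ i - x $ j) \<bullet> (y $ i - y $ j))) / 2"
proof -
  have a: "x \<bullet> laplacian W y = (\<Sum>i\<in>UNIV. \<Sum>j\<in>UNIV. W $ i $ j * (x $ i \<bullet> (y $ i - y $ j)))"
    by (simp add: inner_vec_def laplacian_def inner_sum_right)
  also have "\<dots> = (\<Sum>j\<in>UNIV. \<Sum>i\<in>UNIV. W $ i $ j * (x $ i \<bullet> (y $ i - y $ j)))"
    by (rule sum.swap)
  also have "\<dots> = (\<Sum>i\<in>UNIV. \<Sum>j\<in>UNIV. - (W $ i $ j * (x $ j \<bullet> (y $ i - y $ j))))"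
  proof (intro sum.cong refl)
    fix i j
    show "W $ j $ i * (x $ j \<bullet> (y $ j - y $ i)) = - (W $ i $ j * (x $ j \<bullet> (y $ i - y $ j)))"
      unfolding weight_commute[of j i] by (simp add: inner_diff_right algebra_simps)
  qed
  finally have "2 * (x \<bullet> laplacian W y) =
      (\<Sum>i\<in>UNIV. \<Sum>j\<in>UNIV. W $ i $ j * (x $ i \<bullet> (y $ i - y $ j))) +
      (\<Sum>i\<in>UNIV. \<Sum>j\<in>UNIV. - (W $ i $ j * (x $ j \<bullet> (y $ i - y $ j))))"
    using a by simp
  also have "\<dots> = (\<Sum>i\<in>UNIV. \<Sum>j\<in>UNIV. W $ i $ j * ((x $ i - x $ j) \<bullet> (y $ i - y $ j)))"
    by (simp add: sum.distrib[symmetric] inner_diff_left algebra_simps)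
  finally show ?thesis
    by simp
qed

lemma laplacian_self_adjoint: "x \<bullet> laplacian W y = laplacian W x \<bullet> y"
  by (subst inner_commute[of "laplacian W x"]) (simp add: inner_laplacian inner_commute)

lemma sum_laplacian: "(\<Sum>i\<in>UNIV. laplacian W x $ i) = 0"
proof -
  have "(\<chi> i. v) \<bullet> laplacian W x = 0" for v
    by (simp add: inner_laplacian)
  then have "v \<bullet> (\<Sum>i\<in>UNIV. laplacian W x $ i) = 0" for v
    by (simp add: inner_vec_def inner_sum_right)
  from this[of "\<Sum>i\<in>UNIV. laplacian W x $ i"] show ?thesis
    by simp
qed

lemma laplacian_nonneg:
  assumes "\<And>i j. 0 \<le> W $ i $ j"
  shows "0 \<le> x \<bullet> laplacian W x"
  unfolding inner_laplacian using assms by (intro divide_nonneg_nonneg sum_nonneg) auto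

end

lemma weighted_adjacency_sym: "weighted_adjacency E W \<Longrightarrow> transpose W = W"
  by (simp add: weighted_adjacency_def)

lemma weighted_adjacency_nonneg:
  assumes "weighted_adjacency E W"
  shows "0 \<le> W $ i $ j"
proof -
  have "if (i, j) \<in> E then 0 < W $ i $ j else W $ i $ j = 0"
    using assms by (simp add: weighted_adjacency_def)
  then show ?thesis
    by (simp split: if_splits)
qed

context
  fixes E :: "('n::finite \<times> 'n) set" and W :: "real^'n^'n"
  assumes adj: "weighted_adjacency E W" and conn: "connected_graph E"
begin

text \<open>Zero Dirichlet energy annihilates every nonnegative summand, so x agrees across each
  edge; connectedness carries the equality along a path.\<close>

lemma laplacian_kernel:
  assumes "x \<bullet> laplacian W x = 0"
  shows "x $ i = x $ j"
proof -
  have nn: "0 \<le> W $ i $ j * ((x $ i - x $ j) \<bullet> (x $ i - x $ j))" for i j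
    using weighted_adjacency_nonneg[OF adj] by simp
  have "(\<Sum>i\<in>UNIV. \<Sum>j\<in>UNIV. W $ i $ j * ((x $ i - x $ j) \<bullet> (x $ i - x $ j))) = 0"
    using assms by (simp add: inner_laplacian[OF weighted_adjacency_sym[OF adj]])
  then have zero: "W $ i $ j * ((x $ i - x $ j) \<bullet> (x $ i - x $ j)) = 0" for i j
    using nn by (simp add: sum_nonneg_eq_0_iff sum_nonneg)
  then have edge: "x $ i = x $ j" if "(i, j) \<in> E" for i j
  proof -
    have "if (i, j) \<in> E then 0 < W $ i $ j else W $ i $ j = 0"
      using adj by (simp add: weighted_adjacency_def)
    then have "0 < W $ i $ j"
      using that by simp
    then show ?thesis
      using zero[of i j] by simp
  qed
  have "(i, j) \<in> E\<^sup>*"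
    using conn by (simp add: connected_graph_def)
  then show ?thesis
    by induction (auto dest: edge)
qed

text \<open>Adding the averaging projection fills the kernel of the Laplacian, and \<open>P\<close>
  inverts the sum \<open>K\<close>. On zero-sum vectors this is the Moore-Penrose inverse; on
  consensus vectors \<open>P\<close> is the identity, which is why \<open>P\<close> recovers y from
  its Laplacian up to the average.\<close>

lemma laplacian_pseudoinverse:
  obtains P :: "'a::euclidean_space^'n \<Rightarrow> 'a^'n"
  where "linear P"
    and "\<And>q. (\<Sum>i\<in>UNIV. q $ i) = 0 \<Longrightarrow> laplacian W (P q) = q"
    and "\<And>q. (\<Sum>i\<in>UNIV. q $ i) = 0 \<Longrightarrow> (\<Sum>i\<in>UNIV. P q $ i) = 0"
    and "\<And>y. P (laplacian W y) = y - average y"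
proof -
  define K :: "'a^'n \<Rightarrow> 'a^'n" where "K x = laplacian W x + average x" for x
  have linK: "linear K"
    unfolding K_def by (intro linear_compose_add linear_laplacian linear_average)
  \<comment> \<open>\<open>K\<close> preserves the agent sum. Hence a vector killed by
    \<open>K\<close> has zero sum, its average vanishes, and it lies in the kernel of the
    Laplacian.\<close>
  have sumK: "(\<Sum>i\<in>UNIV. K x $ i) = (\<Sum>i\<in>UNIV. x $ i)" for x
    using sum_laplacian[OF weighted_adjacency_sym[OF adj], of x]
    by (simp add: K_def sum.distrib average_def sum_constant_scaleR)
  have "x = 0" if "K x = 0" for x
  proof -
    have s: "(\<Sum>i\<in>UNIV. x $ i) = 0"
      using sumK[of x] that by simp
    then have "average x = 0"
      by (simp add: average_def vec_eq_iff)
    then have "laplacian W x = 0"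
      using that by (simp add: K_def)
    then have c: "x $ i = x $ j" for i j
      by (intro laplacian_kernel) simp
    have "(\<Sum>i\<in>UNIV. x $ i) = (\<Sum>i\<in>(UNIV :: 'n set). x $ j)" for j
      by (rule sum.cong[OF refl], rule c)
    then have "x $ j = 0" for j
      using s by (simp add: sum_constant_scaleR)
    then show ?thesis
      by (simp add: vec_eq_iff)
  qed
  then have "inj K"
    using linK by (simp add: linear_injective_0)
  then obtain P where P: "linear P" "\<And>x. P (K x) = x" "\<And>x. K (P x) = x"
    using linear_injective_isomorphism[OF linK] by blast
  have z: "(\<Sum>i\<in>UNIV. P q $ i) = 0" if "(\<Sum>i\<in>UNIV. q $ i) = 0" for q
    using that sumK[of "P q"] by (simp add: P(3))
  show thesis
  proof (rule that[OF P(1) _ z])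
    fix q :: "'a^'n"
    assume "(\<Sum>i\<in>UNIV. q $ i) = 0"
    then have "average (P q) = 0"
      using z by (simp add: average_def vec_eq_iff)
    then show "laplacian W (P q) = q"
      using P(3)[of q] by (simp add: K_def)
  next
    fix y :: "'a^'n"
    have "laplacian W (average y) = 0"
      by (simp add: laplacian_def average_def vec_eq_iff)
    moreover have "average (average y) = average y"
      by (simp add: average_def vec_eq_iff sum_constant_scaleR)
    ultimately have "K (y - average y) = laplacian W y"
      by (simp add: K_def linear_diff[OF linear_laplacian] linear_diff[OF linear_average])
    then show "P (laplacian W y) = y - average y"
      by (metis P(2))
  qed auto
qed

end

section \<open>A Lyapunov function for perturbed gradient tracking\<close>

text \<open>Half of the dissipation \<open>c0\<close> pays for the sampling errors. The part of
  \<eta> proportional to the state costs c0/8 (X+Q)^2 by smallness of \<open>lam\<close>, the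
  external part \<open>s\<close> costs the same plus an s^2 term by completing the square, and
  (X+Q)^2 \<le> 2 (X^2+Q^2).\<close>

lemma quadratic_input_bound:
  fixes c0 B H lam X Q \<eta> s :: real
  assumes pos: "0 < c0" "0 < B" "0 < H" and nn: "0 \<le> X" "0 \<le> Q"
    and lam: "lam < c0 / (8 * B * H)"
    and \<eta>: "\<eta> \<le> lam * (H * (X + Q)) + s"
  shows "B * (\<eta> * (X + Q)) \<le> c0 / 2 * (X\<^sup>2 + Q\<^sup>2) + 2 * B\<^sup>2 / c0 * s\<^sup>2"
proof -
  define S where "S = X + Q"
  have S: "0 \<le> S" "S\<^sup>2 \<le> 2 * (X\<^sup>2 + Q\<^sup>2)"
    using nn zero_le_power2[of "X - Q"] by (simp_all add: S_def power2_eq_square algebra_simps)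
  have "B * (lam * H) \<le> c0 / 8"
    using lam pos by (simp add: field_simps)
  then have "B * (lam * H) * S\<^sup>2 \<le> c0 / 8 * S\<^sup>2"
    by (rule mult_right_mono) simp
  moreover have "B * (s * S) \<le> c0 / 8 * S\<^sup>2 + 2 * B\<^sup>2 / c0 * s\<^sup>2"
  proof -
    have "0 \<le> (c0 * S - 4 * B * s)\<^sup>2 / (8 * c0)"
      using pos by simp
    also have "\<dots> = c0 / 8 * S\<^sup>2 + 2 * B\<^sup>2 / c0 * s\<^sup>2 - B * (s * S)"
      using pos by (simp add: field_simps power2_eq_square)
    finally show ?thesis
      by simp
  qed
  moreover have "B * (\<eta> * S) \<le> B * ((lam * (H * S) + s) * S)"
    using \<eta> S(1) pos by (intro mult_left_mono mult_right_mono) (simp_all add: S_def)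
  moreover have "B * ((lam * (H * S) + s) * S) = B * (lam * H) * S\<^sup>2 + B * (s * S)"
    by (simp add: power2_eq_square algebra_simps)
  moreover have "c0 / 4 * S\<^sup>2 \<le> c0 / 4 * (2 * (X\<^sup>2 + Q\<^sup>2))"
    using S(2) pos by (intro mult_left_mono) auto
  ultimately show ?thesis
    unfolding S_def[symmetric] by linarith
qed

text \<open>Since x' contains -L p, the derivative of the cross term contributes -\<epsilon> |L
  p|^2, a dissipation in p that the two squares alone do not produce.\<close>

definition lyapunov :: "('a::real_inner \<Rightarrow> 'a) \<Rightarrow> real \<Rightarrow> 'a \<Rightarrow> 'a \<Rightarrow> real" where
  "lyapunov L \<epsilon> x p = (norm x)\<^sup>2 / 2 + (norm p)\<^sup>2 / 2 + \<epsilon> * (x \<bullet> L p)"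

text \<open>The condition \<open>\<epsilon> * l \<le> 1 / 2\<close> keeps the cross term below half
  of the energy.\<close>

lemma lyapunov_ge:
  assumes "\<And>x. norm (L x) \<le> l * norm x" and "0 < \<epsilon>" "\<epsilon> * l \<le> 1 / 2"
  shows "((norm x)\<^sup>2 + (norm p)\<^sup>2) / 4 \<le> lyapunov L \<epsilon> x p"
proof -
  have "\<epsilon> * (- (x \<bullet> L p)) \<le> \<epsilon> * (norm x * (l * norm p))"
    using assms Cauchy_Schwarz_ineq2[of x "L p"] mult_left_mono[OF assms(1)[of p], of "norm x"]
    by (intro mult_left_mono) auto
  also have "\<dots> = (\<epsilon> * l) * (norm x * norm p)"
    by simp
  also have "\<dots> \<le> 1 / 2 * (norm x * norm p)"
    using assms by (intro mult_right_mono) auto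
  also have "\<dots> \<le> ((norm x)\<^sup>2 + (norm p)\<^sup>2) / 4"
    using zero_le_power2[of "norm x - norm p"] by (simp add: power2_eq_square algebra_simps)
  finally show ?thesis
    by (simp add: lyapunov_def)
qed

text \<open>
  Here \<open>x\<close> is centred at the optimum, \<open>g\<close> is the gradient increment, \<open>ex\<close> and \<open>eh\<close> are
  the sampling errors of \<open>x\<close> and of \<open>z + \<nabla>f\<close>, and \<open>v\<close> is the consensus component
  that the pseudoinverse removes; the left-hand side of the last inequality is the derivative of the
  Lyapunov function along the closed loop.
\<close>
definition dissipative ::
  "('a::real_inner \<Rightarrow> 'a) \<Rightarrow> real \<Rightarrow> real \<Rightarrow> real \<Rightarrow> real \<Rightarrow> real \<Rightarrow> real \<Rightarrow> real \<Rightarrow> bool" where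
  "dissipative L \<alpha> \<beta> \<kappa> \<epsilon> c D lamstar \<longleftrightarrow>
    (\<forall>x p g ex eh v \<eta> lam s.
      norm p \<le> \<kappa> * norm (L p) \<longrightarrow> \<alpha> * (norm x)\<^sup>2 \<le> g \<bullet> x \<longrightarrow> norm g \<le> \<beta> * norm x \<longrightarrow>
      norm ex \<le> \<eta> \<longrightarrow> norm eh \<le> 2 * \<eta> \<longrightarrow>
      \<eta> \<le> lam * norm (L p + L x + g) + s \<longrightarrow> 0 \<le> lam \<longrightarrow> lam < lamstar \<longrightarrow>
      p \<bullet> v = 0 \<longrightarrow> L v = 0 \<longrightarrow>
      x \<bullet> (- 2 *\<^sub>R L x - L p - g - L ex) + p \<bullet> (L x + L ex - eh - v) +
        \<epsilon> * ((- 2 *\<^sub>R L x - L p - g - L ex) \<bullet> L p + x \<bullet> L (L x + L ex - eh - v))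
      \<le> - c * lyapunov L \<epsilon> x p + D * s\<^sup>2)"

text \<open>The squares contribute \<open>V1\<close>, with -\<alpha> |x|^2 after the skew coupling
  cancels. The cross term contributes \<epsilon> \<open>V2\<close>, with -|L p|^2 / 2 at the price
  of A |x|^2, affordable once \<epsilon> A \<le> \<alpha> / 2. Terms with \<eta> go to
  \<open>quadratic_input_bound\<close>, and \<kappa> converts |L p| back into |p|.\<close>

lemma lyapunov_dissipation:
  fixes L :: "'a::real_inner \<Rightarrow> 'a"
  assumes L: "linear L" and self_adjoint: "\<And>x y. x \<bullet> L y = L x \<bullet> y"
    and psd: "\<And>x. 0 \<le> x \<bullet> L x"
    and bound: "\<And>x. norm (L x) \<le> l * norm x"
    and pos: "0 < l" "0 < \<alpha>" "0 < \<beta>" "0 < \<kappa>"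
  obtains \<epsilon> c D lamstar where "0 < \<epsilon>" "\<epsilon> * l \<le> 1 / 2" "0 < c" "0 < D" "0 < lamstar"
    and "dissipative L \<alpha> \<beta> \<kappa> \<epsilon> c D lamstar"
proof -
  \<comment> \<open>In \<open>V2\<close>, l^2 bounds the |L x|^2 term; the second summand comes from
    Young's inequality for (2 l + \<beta>) X Q, which spends half of the available Q^2.\<close>
  define A where "A = l\<^sup>2 + (2 * l + \<beta>)\<^sup>2 / 2"
  \<comment> \<open>\<open>B\<close> adds up the coefficients of X \<eta> and Q \<eta> from both
    \<open>V1\<close> and \<open>V2\<close>; \<open>H\<close> below bounds the trigger quantity h by
    H (X + Q).\<close>
  define B where "B = (l + l * (l + 2)) + (\<kappa> * (l + 2) + l)"
  define H where "H = 1 + l + \<beta>"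
  have AB: "0 < A" "0 < B" "0 < H"
    using pos by (auto simp: A_def B_def H_def intro!: add_pos_pos)
  define \<epsilon> where "\<epsilon> = min 1 (min (1 / (2 * l)) (\<alpha> / (2 * A)))"
  have \<epsilon>: "0 < \<epsilon>" "\<epsilon> \<le> 1" "\<epsilon> \<le> 1 / (2 * l)" "\<epsilon> \<le> \<alpha> / (2 * A)"
    using pos AB by (auto simp: \<epsilon>_def)
  have \<epsilon>l: "\<epsilon> * l \<le> 1 / 2" and \<epsilon>A: "\<epsilon> * A \<le> \<alpha> / 2"
    using \<epsilon>(3,4) pos AB by (simp_all add: field_simps)
  define c0 where "c0 = min (\<alpha> / 2) (\<epsilon> / 2)"
  have c0: "0 < c0" "c0 \<le> \<alpha> / 2" "c0 \<le> \<epsilon> / 2"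
    using pos \<epsilon> by (auto simp: c0_def)
  \<comment> \<open>The half of \<open>c0\<close> left after the sampling errors, divided by 1 +
    \<kappa>^2 because \<open>lyapunov\<close> is at most (1 + \<kappa>^2) (X^2 + Q^2).\<close>
  define c where "c = c0 / (2 * (1 + \<kappa>\<^sup>2))"
  have k: "0 < 1 + \<kappa>\<^sup>2"
    by (simp add: add_pos_nonneg)
  have c: "0 < c" "c * (1 + \<kappa>\<^sup>2) = c0 / 2"
    using c0 k by (auto simp: c_def field_simps)
  show thesis
  proof (rule that[of \<epsilon> c "2 * B\<^sup>2 / c0" "c0 / (8 * B * H)"], goal_cases)
    case 6
    show ?case
      unfolding dissipative_def
    proof (intro allI impI)
      fix x p g ex eh v :: 'a and \<eta> lam s :: real
      assume p: "norm p \<le> \<kappa> * norm (L p)" and g: "\<alpha> * (norm x)\<^sup>2 \<le> g \<bullet> x" "norm g \<le> \<beta> * norm x"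
        and e: "norm ex \<le> \<eta>" "norm eh \<le> 2 * \<eta>"
        and \<eta>: "\<eta> \<le> lam * norm (L p + L x + g) + s" and lam: "0 \<le> lam" "lam < c0 / (8 * B * H)"
        and v: "p \<bullet> v = 0" "L v = 0"
      define X where "X = norm x"
      define Q where "Q = norm (L p)"
      define w where "w = L ex - eh"
      have nn: "0 \<le> X" "0 \<le> Q" "0 \<le> \<eta>"
        using order_trans[OF norm_ge_zero e(1)] by (simp_all add: X_def Q_def)
      have Lx: "norm (L x) \<le> l * X"
        using bound by (simp add: X_def)
      have Lex: "norm (L ex) \<le> l * \<eta>"
        using bound[of ex] mult_left_mono[OF e(1), of l] pos by linarith
      have w: "norm w \<le> (l + 2) * \<eta>"
        using norm_triangle_ineq4[of "L ex" eh] Lex e by (simp add: w_def algebra_simps)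
      have cs: "a \<bullet> b \<le> r * t" if "norm a \<le> r" "norm b \<le> t" for a b :: 'a and r t
        using norm_cauchy_schwarz[of a b] mult_mono[OF that order_trans[OF norm_ge_zero that(1)] norm_ge_zero]
        by linarith
      have x1: "- (x \<bullet> L ex) \<le> l * (X * \<eta>)"
        using cs[of "- x" X "L ex" "l * \<eta>"] Lex by (simp add: X_def algebra_simps)
      have x2: "p \<bullet> w \<le> \<kappa> * (l + 2) * (Q * \<eta>)"
        using cs[of p "\<kappa> * Q" w "(l + 2) * \<eta>"] p w by (simp add: Q_def algebra_simps)
      have x3: "- (L x \<bullet> L p) \<le> l * (X * Q)"
        using cs[of "- L x" "l * X" "L p" Q] Lx by (simp add: Q_def)
      have x4: "- (g \<bullet> L p) \<le> \<beta> * (X * Q)"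
        using cs[of "- g" "\<beta> * X" "L p" Q] g(2) by (simp add: X_def Q_def)
      have x5: "- (L ex \<bullet> L p) \<le> l * (Q * \<eta>)"
        using cs[of "- L ex" "l * \<eta>" "L p" Q] Lex by (simp add: Q_def mult_ac)
      have x6: "L x \<bullet> L x \<le> l\<^sup>2 * X\<^sup>2"
        using cs[OF Lx Lx] by (simp add: power2_eq_square algebra_simps)
      have x7: "L x \<bullet> w \<le> l * (l + 2) * (X * \<eta>)"
        using cs[OF Lx w] by (simp add: algebra_simps)
      have x8: "L p \<bullet> L p = Q\<^sup>2"
        by (simp add: Q_def power2_norm_eq_inner)
      define V1 where "V1 = x \<bullet> (- 2 *\<^sub>R L x - L p - g - L ex) + p \<bullet> (L x + L ex - eh - v)"
      define V2 where "V2 = (- 2 *\<^sub>R L x - L p - g - L ex) \<bullet> L p + x \<bullet> L (L x + L ex - eh - v)"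
      have "V1 = - 2 * (x \<bullet> L x) - g \<bullet> x - x \<bullet> L ex + p \<bullet> w"
        using v(1) self_adjoint[of x p] unfolding V1_def w_def
        by (simp add: inner_diff_right inner_add_right inner_commute)
      then have V1: "V1 \<le> - \<alpha> * X\<^sup>2 + l * (X * \<eta>) + \<kappa> * (l + 2) * (Q * \<eta>)"
        using psd[of x] g(1) x1 x2 by (simp add: X_def)
      have "x \<bullet> L (L x + L ex - eh - v) = L x \<bullet> L x + L x \<bullet> w"
        using v(2) self_adjoint[of x v] unfolding self_adjoint[of x "L x + L ex - eh - v"] w_def
        by (simp add: inner_diff_right inner_add_right)
      then have "V2 = - 2 * (L x \<bullet> L p) - L p \<bullet> L p - g \<bullet> L p - L ex \<bullet> L p + L x \<bullet> L x + L x \<bullet> w"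
        unfolding V2_def by (simp add: inner_diff_left)
      then have "V2 \<le> - Q\<^sup>2 + (2 * l + \<beta>) * (X * Q) + l * (Q * \<eta>) + l\<^sup>2 * X\<^sup>2 + l * (l + 2) * (X * \<eta>)"
        using x3 x4 x5 x6 x7 x8 by (simp add: distrib_right)
      moreover have "(2 * l + \<beta>) * (X * Q) \<le> (2 * l + \<beta>)\<^sup>2 / 2 * X\<^sup>2 + Q\<^sup>2 / 2"
        using sum_squares_bound[of "(2 * l + \<beta>) * X" Q] by (simp add: power_mult_distrib mult.assoc)
      ultimately have "V2 \<le> - (Q\<^sup>2 / 2) + A * X\<^sup>2 + (l * (Q * \<eta>) + l * (l + 2) * (X * \<eta>))"
        unfolding A_def by (simp add: algebra_simps)
      from mult_left_mono[OF this, of \<epsilon>]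
      have "\<epsilon> * V2 \<le> - (\<epsilon> / 2) * Q\<^sup>2 + (\<epsilon> * A) * X\<^sup>2 + \<epsilon> * (l * (Q * \<eta>) + l * (l + 2) * (X * \<eta>))"
        using \<epsilon> by (simp add: algebra_simps)
      moreover have "\<epsilon> * (l * (Q * \<eta>) + l * (l + 2) * (X * \<eta>)) \<le> 1 * (l * (Q * \<eta>) + l * (l + 2) * (X * \<eta>))"
        using \<epsilon> nn pos by (intro mult_right_mono add_nonneg_nonneg mult_nonneg_nonneg) auto
      moreover have "(\<epsilon> * A) * X\<^sup>2 \<le> \<alpha> / 2 * X\<^sup>2"
        using \<epsilon>A by (intro mult_right_mono) auto
      ultimately have "V1 + \<epsilon> * V2 \<le> - (\<alpha> / 2) * X\<^sup>2 - \<epsilon> / 2 * Q\<^sup>2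
          + (l + l * (l + 2)) * (X * \<eta>) + (\<kappa> * (l + 2) + l) * (Q * \<eta>)"
        using V1 by (simp add: algebra_simps)
      moreover have "(l + l * (l + 2)) * (X * \<eta>) \<le> B * (X * \<eta>)" "(\<kappa> * (l + 2) + l) * (Q * \<eta>) \<le> B * (Q * \<eta>)"
        using nn pos by (intro mult_right_mono; simp add: B_def)+
      moreover have "c0 * X\<^sup>2 \<le> \<alpha> / 2 * X\<^sup>2" "c0 * Q\<^sup>2 \<le> \<epsilon> / 2 * Q\<^sup>2"
        using c0 by (intro mult_right_mono; simp)+
      ultimately have "V1 + \<epsilon> * V2 \<le> - c0 * (X\<^sup>2 + Q\<^sup>2) + B * (\<eta> * (X + Q))"
        by (simp add: algebra_simps)
      moreover have "B * (\<eta> * (X + Q)) \<le> c0 / 2 * (X\<^sup>2 + Q\<^sup>2) + 2 * B\<^sup>2 / c0 * s\<^sup>2"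
      proof (rule quadratic_input_bound[OF c0(1) AB(2,3) nn(1,2) lam(2)])
        have "norm (L p + L x + g) \<le> Q + l * X + \<beta> * X"
          using norm_triangle_ineq[of "L p + L x" g] norm_triangle_ineq[of "L p" "L x"] Lx g(2)
          by (simp add: X_def Q_def)
        also have "\<dots> \<le> H * (X + Q)"
          using nn pos by (simp add: H_def algebra_simps)
        finally have "lam * norm (L p + L x + g) \<le> lam * (H * (X + Q))"
          using lam(1) by (rule mult_left_mono)
        then show "\<eta> \<le> lam * (H * (X + Q)) + s"
          using \<eta> by linarith
      qed
      moreover have "c * lyapunov L \<epsilon> x p \<le> c0 / 2 * (X\<^sup>2 + Q\<^sup>2)"
      proof -
        have combine: "a / 2 + n / 2 + e \<le> a + k + (q + m)"
          if "n \<le> m" "e \<le> y" "y \<le> (a + q) / 2" "0 \<le> k" "0 \<le> m" "0 \<le> q" "0 \<le> a"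
          for a n e k q m y :: real
          using that by argo
        have "(norm p)\<^sup>2 \<le> \<kappa>\<^sup>2 * Q\<^sup>2"
          using power_mono[OF p, of 2] by (simp add: Q_def power_mult_distrib)
        moreover have "\<epsilon> * (x \<bullet> L p) \<le> 1 * (X * Q)"
          using mult_left_mono[OF norm_cauchy_schwarz[of x "L p"] less_imp_le[OF \<epsilon>(1)]]
            mult_right_mono[OF \<epsilon>(2) mult_nonneg_nonneg[OF nn(1,2)]]
          unfolding X_def Q_def by linarith
        moreover have "X * Q \<le> (X\<^sup>2 + Q\<^sup>2) / 2"
          using sum_squares_bound[of X Q] by simp
        moreover have "0 \<le> \<kappa>\<^sup>2 * X\<^sup>2" "0 \<le> \<kappa>\<^sup>2 * Q\<^sup>2" "0 \<le> Q\<^sup>2" "0 \<le> X\<^sup>2"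
          by simp_all
        ultimately have "lyapunov L \<epsilon> x p \<le> (1 + \<kappa>\<^sup>2) * (X\<^sup>2 + Q\<^sup>2)"
          unfolding lyapunov_def X_def[symmetric] distrib_left distrib_right mult_1
          by (rule combine)
        from mult_left_mono[OF this, of c] show ?thesis
          using c by (simp flip: mult.assoc)
      qed
      ultimately show "x \<bullet> (- 2 *\<^sub>R L x - L p - g - L ex) + p \<bullet> (L x + L ex - eh - v) +
          \<epsilon> * ((- 2 *\<^sub>R L x - L p - g - L ex) \<bullet> L p + x \<bullet> L (L x + L ex - eh - v))
        \<le> - c * lyapunov L \<epsilon> x p + 2 * B\<^sup>2 / c0 * s\<^sup>2"
        unfolding V1_def V2_def by (simp add: algebra_simps)
    qed
  qed (use \<epsilon> \<epsilon>l c c0 AB in auto)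
qed

section \<open>Averages, the derivative of the energy and a decay inequality\<close>

lemma laplacian_const: "laplacian W (\<chi> i. v) = 0"
  by (simp add: laplacian_def vec_eq_iff)

lemma laplacian_average: "laplacian W (average x) = 0"
  unfolding average_def by (rule laplacian_const)

text \<open>Makes a vector with zero agent sum orthogonal to every average, which is the condition
  \<open>p \<bullet> v = 0\<close> in \<open>dissipative\<close>.\<close>

lemma inner_average: "x \<bullet> average y = (\<Sum>i\<in>UNIV. x $ i) \<bullet> (\<Sum>i\<in>UNIV. y $ i) / real CARD('n)"
  for x y :: "'a::real_inner^'n"
  by (simp add: inner_vec_def average_def inner_sum_left sum_divide_distrib)

lemma lyapunov_has_derivative:
  assumes L: "bounded_linear L"
    and x: "(x has_vector_derivative x') (at t within S)"
    and p: "(p has_vector_derivative p') (at t within S)"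
  shows "((\<lambda>t. lyapunov L \<epsilon> (x t) (p t)) has_real_derivative
    x t \<bullet> x' + p t \<bullet> p' + \<epsilon> * (x' \<bullet> L (p t) + x t \<bullet> L p')) (at t within S)"
proof -
  note inner = bounded_bilinear.has_vector_derivative[OF bounded_bilinear_inner]
  have "((\<lambda>t. lyapunov L \<epsilon> (x t) (p t)) has_vector_derivative
      (1 / 2) * (x t \<bullet> x' + x' \<bullet> x t) + (1 / 2) * (p t \<bullet> p' + p' \<bullet> p t) +
      \<epsilon> * (x t \<bullet> L p' + x' \<bullet> L (p t))) (at t within S)"
    unfolding lyapunov_def power2_norm_eq_inner
    using has_vector_derivative_mult_right[OF inner[OF x x], of "1 / 2"]
      has_vector_derivative_mult_right[OF inner[OF p p], of "1 / 2"]
      has_vector_derivative_mult_right[OF inner[OF x bounded_linear.has_vector_derivative[OF L p]], of \<epsilon>]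
    by (intro has_vector_derivative_add) simp_all
  then show ?thesis
    by (simp add: has_real_derivative_iff_has_vector_derivative inner_commute algebra_simps)
qed

text \<open>With the integrating factor exp(ct) the forcing becomes K exp(-ct), exactly compensated
  by the derivative of K/c exp(-ct); hence \<Phi> does not increase. Stated between two endpoints so
  that it can be chained across events.\<close>

lemma differential_inequality_decay:
  fixes v :: "real \<Rightarrow> real"
  assumes c: "0 < c" and "a \<le> b"
    and v: "\<And>t. t \<in> {a..b} \<Longrightarrow> (v has_real_derivative v' t) (at t within {a..b})"
    and le: "\<And>t. t \<in> {a..b} \<Longrightarrow> v' t \<le> - c * v t + K * exp (- (2 * c) * t)"
  shows "exp (c * b) * v b + K / c * exp (- c * b) \<le> exp (c * a) * v a + K / c * exp (- c * a)"
proof -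
  define \<Phi> where "\<Phi> t = exp (c * t) * v t + K / c * exp (- c * t)" for t
  define \<Phi>' where "\<Phi>' t = exp (c * t) * (c * v t + v' t) - K * exp (- c * t)" for t
  have "(\<Phi> has_real_derivative \<Phi>' t) (at t within {a..b})" if "t \<in> {a..b}" for t
    unfolding \<Phi>_def \<Phi>'_def using c
    by (auto intro!: derivative_eq_intros v[OF that] simp: field_simps)
  then have "\<exists>t\<in>{a..b}. \<Phi> b - \<Phi> a = \<Phi>' t * (b - a)"
    using mvt_very_simple[OF \<open>a \<le> b\<close>, of \<Phi> "\<lambda>t. (*) (\<Phi>' t)"] by (simp add: has_field_derivative_def)
  then obtain t where t: "t \<in> {a..b}" "\<Phi> b - \<Phi> a = \<Phi>' t * (b - a)"
    by blast
  have "exp (c * t) * (c * v t + v' t) \<le> exp (c * t) * (K * exp (- (2 * c) * t))"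
    using le[OF t(1)] by (intro mult_left_mono) auto
  also have "\<dots> = K * exp (- c * t)"
    by (simp flip: exp_add)
  finally have "\<Phi>' t \<le> 0"
    by (simp add: \<Phi>'_def)
  then have "\<Phi>' t * (b - a) \<le> 0"
    using \<open>a \<le> b\<close> by (simp add: mult_nonpos_nonneg)
  then show ?thesis
    using t(2) unfolding \<Phi>_def by linarith
qed

section \<open>The network in stacked coordinates and its Lyapunov function\<close>

locale tracking_network =
  fixes f :: "'n::finite \<Rightarrow> real^'d \<Rightarrow> real"
    and E :: "('n \<times> 'n) set" and W :: "real^'n^'n"
    and \<alpha> \<beta> :: real and xstar :: "real^'d"
  assumes \<alpha>_pos: "0 < \<alpha>" and \<beta>_pos: "0 < \<beta>"
    and diff: "\<And>i x. f i differentiable at x"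
    and strong_convex: "\<And>i. strongly_convex \<alpha> (f i)"
    and grad_lipschitz: "\<And>i. \<beta>-lipschitz_on UNIV (grad (f i))"
    and connected: "connected_graph E"
    and adjacency: "weighted_adjacency E W"
    and stationary: "(\<Sum>i\<in>UNIV. grad (f i) xstar) = 0"
begin

abbreviation L :: "real^'d^'n \<Rightarrow> real^'d^'n" where "L \<equiv> laplacian W"

definition G :: "real^'d^'n \<Rightarrow> real^'d^'n" where
  "G x = (\<chi> i. grad (f i) (x $ i))"

definition xbar :: "real^'d^'n" where
  "xbar = (\<chi> i. xstar)"

lemma norm_grad_diff_le: "norm (grad (f i) x - grad (f i) y) \<le> \<beta> * norm (x - y)"
  using lipschitz_onD[OF grad_lipschitz, of x y i] by (simp add: dist_norm)

lemma norm_G_diff_le: "norm (G x - G y) \<le> \<beta> * norm (x - y)"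
proof -
  have "norm (G x - G y) \<le> L2_set (\<lambda>i. \<beta> * norm ((x - y) $ i)) UNIV"
    unfolding norm_vec_def[of "G x - G y"]
    by (rule L2_set_mono) (simp_all only: G_def vector_minus_component vec_lambda_beta norm_grad_diff_le norm_ge_zero)
  also have "\<dots> = \<beta> * norm (x - y)"
    unfolding norm_vec_def[of "x - y"] using \<beta>_pos by (simp only: L2_set_right_distrib less_imp_le)
  finally show ?thesis .
qed

lemma G_strongly_monotone: "\<alpha> * (norm (x - y))\<^sup>2 \<le> (G x - G y) \<bullet> (x - y)"
proof -
  have "\<alpha> * (norm (x - y))\<^sup>2 = (\<Sum>i\<in>UNIV. \<alpha> * (norm (x $ i - y $ i))\<^sup>2)"
    by (simp add: power2_norm_eq_inner inner_vec_def sum_distrib_left)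
  also have "\<dots> \<le> (\<Sum>i\<in>UNIV. (grad (f i) (x $ i) - grad (f i) (y $ i)) \<bullet> (x $ i - y $ i))"
    by (intro sum_mono strongly_convex_grad_mono strong_convex diff)
  finally show ?thesis
    by (simp add: G_def inner_vec_def)
qed

lemma bounded_linear_L: "bounded_linear L"
  by (simp add: linear_laplacian linear_conv_bounded_linear[symmetric])

lemma L_bound:
  obtains l where "0 < l" "\<And>x. norm (L x) \<le> l * norm x"
  using bounded_linear.pos_bounded[OF bounded_linear_L] by (metis mult.commute)

lemmas L_self_adjoint = laplacian_self_adjoint[OF weighted_adjacency_sym[OF adjacency]]

lemma sum_L: "(\<Sum>i\<in>UNIV. L x $ i) = 0"
  by (rule sum_laplacian[OF weighted_adjacency_sym[OF adjacency]])

end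

text \<open>Interface between the energy analysis and the analysis of events: \<open>V\<close> is a
  function of the original variables, with the pseudoinverse hidden. In
  \<open>lyapunov_decay\<close>, \<open>xh\<close> and \<open>yh\<close> are the held values of x
  and of z + \<nabla>f, constant on the interval; the same expression appears at both endpoints, so
  the inequality telescopes over events.\<close>

locale tracking_lyapunov = tracking_network f E W \<alpha> \<beta> xstar
  for f :: "'n::finite \<Rightarrow> real^'d \<Rightarrow> real"
    and E :: "('n \<times> 'n) set" and W :: "real^'n^'n" and \<alpha> \<beta> :: real and xstar :: "real^'d" +
  fixes V :: "real^'d^'n \<Rightarrow> real^'d^'n \<Rightarrow> real" and c D lamstar :: real
  assumes c_pos: "0 < c" and D_pos: "0 < D" and lamstar_pos: "0 < lamstar"
    and norm_error_le: "\<And>x z. (norm (x - xbar))\<^sup>2 \<le> 4 * V x z"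
    and sublevel_bounded: "\<And>r. \<exists>B>0. \<forall>x z. (\<Sum>i\<in>UNIV. z $ i) = 0 \<longrightarrow> V x z \<le> r \<longrightarrow> norm x \<le> B \<and> norm z \<le> B"
    and lyapunov_decay: "\<And>a b X Z xh yh lam S. a \<le> b \<Longrightarrow> (\<Sum>i\<in>UNIV. Z a $ i) = 0 \<Longrightarrow>
      (\<And>t. t \<in> {a..b} \<Longrightarrow> (X has_vector_derivative - L xh - Z t - G (X t)) (at t within {a..b})) \<Longrightarrow>
      (\<And>t. t \<in> {a..b} \<Longrightarrow> (Z has_vector_derivative - L yh) (at t within {a..b})) \<Longrightarrow>
      (\<And>t. t \<in> {a..b} \<Longrightarrow> \<exists>\<eta>. norm (xh - X t) \<le> \<eta> \<and> norm (yh - (Z t + G (X t))) \<le> 2 * \<eta> \<and>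
         \<eta> \<le> lam * norm (Z t + G (X t)) + S * exp (- c * t)) \<Longrightarrow>
      0 \<le> lam \<Longrightarrow> lam < lamstar \<Longrightarrow>
      (\<Sum>i\<in>UNIV. Z b $ i) = 0 \<and>
      exp (c * b) * V (X b) (Z b) + D * S\<^sup>2 / c * exp (- c * b)
        \<le> exp (c * a) * V (X a) (Z a) + D * S\<^sup>2 / c * exp (- c * a)"

text \<open>\<open>V\<close> is \<open>lyapunov\<close> in the coordinates x - \<open>xbar\<close>
  and p = P q. Bounded sublevels follow by undoing the change of variables: q = L p, and z is
  recovered from q and x.\<close>

lemma (in tracking_network) tracking_lyapunov_exists:
  obtains V c D lamstar where "tracking_lyapunov f E W \<alpha> \<beta> xstar V c D lamstar"
proof -
  obtain l where l: "0 < l" "\<And>x. norm (L x) \<le> l * norm x"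
    using L_bound by blast
  obtain P :: "real^'d^'n \<Rightarrow> real^'d^'n" where P: "linear P"
    and LP: "\<And>q. (\<Sum>i\<in>UNIV. q $ i) = 0 \<Longrightarrow> L (P q) = q"
    and sumP: "\<And>q. (\<Sum>i\<in>UNIV. q $ i) = 0 \<Longrightarrow> (\<Sum>i\<in>UNIV. P q $ i) = 0"
    and PL: "\<And>y. P (L y) = y - average y"
    by (rule laplacian_pseudoinverse[OF adjacency connected]) (rule that; iprover)
  have blP: "bounded_linear P"
    using P by (simp add: linear_conv_bounded_linear)
  obtain \<kappa> where \<kappa>: "0 < \<kappa>" "\<And>q. norm (P q) \<le> \<kappa> * norm q"
    using bounded_linear.pos_bounded[OF blP] by (metis mult.commute)
  obtain \<epsilon> c D lamstar where \<epsilon>: "0 < \<epsilon>" "\<epsilon> * l \<le> 1 / 2" and cD: "0 < c" "0 < D" "0 < lamstar"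
    and dissip: "dissipative L \<alpha> \<beta> \<kappa> \<epsilon> c D lamstar"
    by (rule lyapunov_dissipation[of L l \<alpha> \<beta> \<kappa>, OF linear_laplacian L_self_adjoint
        laplacian_nonneg[OF weighted_adjacency_sym[OF adjacency] weighted_adjacency_nonneg[OF adjacency]]
        l(2,1) \<alpha>_pos \<beta>_pos \<kappa>(1)])
  note diss = dissip[unfolded dissipative_def, rule_format]
  define q where "q x z = z + G xbar - L (x - xbar)" for x z
  define V where "V x z = lyapunov L \<epsilon> (x - xbar) (P (q x z))" for x z
  have sumq: "(\<Sum>i\<in>UNIV. q x z $ i) = 0" if "(\<Sum>i\<in>UNIV. z $ i) = 0" for x z
    using that stationary sum_L by (simp add: q_def sum.distrib sum_subtractf G_def xbar_def)
  have V: "((norm (x - xbar))\<^sup>2 + (norm (P (q x z)))\<^sup>2) / 4 \<le> V x z" for x z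
    unfolding V_def using lyapunov_ge[OF l(2) \<epsilon>] .
  show thesis
  proof (rule that[of V c D lamstar], unfold_locales)
    show "0 < c" "0 < D" "0 < lamstar"
      by (fact cD)+
  next
    fix x z :: "real^'d^'n"
    show "(norm (x - xbar))\<^sup>2 \<le> 4 * V x z"
      using V[of x z] zero_le_power2[of "norm (P (q x z))"] by argo
  next
    fix r :: real
    define R where "R = sqrt (4 * max r 0)"
    define B where "B = R + norm xbar + (l * R + norm (G xbar) + l * R) + 1"
    have R: "0 \<le> R"
      by (simp add: R_def)
    have lR: "0 \<le> l * R"
      using R l by simp
    have "norm x \<le> B \<and> norm z \<le> B" if z: "(\<Sum>i\<in>UNIV. z $ i) = 0" and r: "V x z \<le> r" for x z
    proof -
      have "(norm (x - xbar))\<^sup>2 \<le> 4 * max r 0" "(norm (P (q x z)))\<^sup>2 \<le> 4 * max r 0"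
        using V[of x z] r zero_le_power2[of "norm (P (q x z))"] zero_le_power2[of "norm (x - xbar)"]
        by argo+
      then have x: "norm (x - xbar) \<le> R" and p: "norm (P (q x z)) \<le> R"
        by (simp_all add: R_def real_le_rsqrt)
      have nx: "norm x \<le> R + norm xbar"
        using x norm_triangle_ineq[of "x - xbar" xbar] by simp
      have "norm (q x z) \<le> l * R"
        using order_trans[OF l(2)[of "P (q x z)"] mult_left_mono[OF p]] l(1) LP[OF sumq[OF z], of x] by simp
      moreover have "norm (L (x - xbar)) \<le> l * R"
        using order_trans[OF l(2)[of "x - xbar"] mult_left_mono[OF x]] l(1) by simp
      moreover have "z = q x z - G xbar + L (x - xbar)"
        by (simp add: q_def)
      then have "norm z \<le> norm (q x z) + norm (G xbar) + norm (L (x - xbar))"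
        by (smt (verit) norm_triangle_ineq norm_triangle_ineq4)
      ultimately show ?thesis
        using nx R lR unfolding B_def by (smt (verit) norm_ge_zero)
    qed
    moreover have "0 < B"
      unfolding B_def using R lR by (smt (verit) norm_ge_zero)
    ultimately show "\<exists>B>0. \<forall>x z. (\<Sum>i\<in>UNIV. z $ i) = 0 \<longrightarrow> V x z \<le> r \<longrightarrow> norm x \<le> B \<and> norm z \<le> B"
      by blast
  next
    fix a b :: real and X Z :: "real \<Rightarrow> real^'d^'n" and xh yh and lam S :: real
    assume ab: "a \<le> b" and Za: "(\<Sum>i\<in>UNIV. Z a $ i) = 0"
      and X': "\<And>t. t \<in> {a..b} \<Longrightarrow> (X has_vector_derivative - L xh - Z t - G (X t)) (at t within {a..b})"
      and Z': "\<And>t. t \<in> {a..b} \<Longrightarrow> (Z has_vector_derivative - L yh) (at t within {a..b})"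
      and err: "\<And>t. t \<in> {a..b} \<Longrightarrow> \<exists>\<eta>. norm (xh - X t) \<le> \<eta> \<and> norm (yh - (Z t + G (X t))) \<le> 2 * \<eta> \<and>
         \<eta> \<le> lam * norm (Z t + G (X t)) + S * exp (- c * t)"
      and lam: "0 \<le> lam" "lam < lamstar"
    \<comment> \<open>The z equation has its right-hand side in the range of L, where agent sums
      vanish, so the sum of z is conserved.\<close>
    have "linear (\<lambda>v :: real^'d^'n. \<Sum>i\<in>UNIV. v $ i)"
      by (rule linearI) (simp_all add: sum.distrib scaleR_sum_right)
    then have "bounded_linear (\<lambda>v :: real^'d^'n. \<Sum>i\<in>UNIV. v $ i)"
      by (simp add: linear_conv_bounded_linear)
    from bounded_linear.has_vector_derivative[OF this Z']
    have "((\<lambda>t. \<Sum>i\<in>UNIV. Z t $ i) has_vector_derivative 0) (at t within {a..b})" if "t \<in> {a..b}" for t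
      using that by (simp add: sum_negf sum_L)
    then obtain C where "\<And>t. t \<in> {a..b} \<Longrightarrow> (\<Sum>i\<in>UNIV. Z t $ i) = C"
      using has_vector_derivative_zero_constant[of "{a..b}" "\<lambda>t. \<Sum>i\<in>UNIV. Z t $ i"] by auto
    then have sumZ: "(\<Sum>i\<in>UNIV. Z t $ i) = 0" if "t \<in> {a..b}" for t
      using that Za ab by (metis atLeastAtMost_iff order_refl)
    \<comment> \<open>The average lost when \<open>P\<close> undoes L; L kills it and p is
      orthogonal to it, so it leaves no trace in the energy balance.\<close>
    define v where "v t = average (L (X t - xbar) + L (xh - X t) - (yh - (Z t + G (X t))))" for t
    define x' where "x' t = - 2 *\<^sub>R L (X t - xbar) - L (P (q (X t) (Z t))) - (G (X t) - G xbar) - L (xh - X t)" for t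
    define p' where "p' t = L (X t - xbar) + L (xh - X t) - (yh - (Z t + G (X t))) - v t" for t
    define V' where "V' t = (X t - xbar) \<bullet> x' t + P (q (X t) (Z t)) \<bullet> p' t +
        \<epsilon> * (x' t \<bullet> L (P (q (X t) (Z t))) + (X t - xbar) \<bullet> L (p' t))" for t
    note lin = linear_diff[OF linear_laplacian] linear_add[OF linear_laplacian] linear_neg[OF linear_laplacian]
    have Lxbar: "L xbar = 0"
      unfolding xbar_def by (rule laplacian_const)
    have "((\<lambda>t. V (X t) (Z t)) has_real_derivative V' t) (at t within {a..b})" if t: "t \<in> {a..b}" for t
      unfolding V_def V'_def
    proof (rule lyapunov_has_derivative[OF bounded_linear_L])
      have "x' t = - L xh - Z t - G (X t)"
        unfolding x'_def LP[OF sumq[OF sumZ[OF t]]] by (simp add: q_def lin Lxbar scaleR_2)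
      then show dx: "((\<lambda>t. X t - xbar) has_vector_derivative x' t) (at t within {a..b})"
        using X'[OF t] by (auto intro!: derivative_eq_intros)
      \<comment> \<open>The derivative of q, namely z' - L x', is L applied to the bracket;
        \<open>P\<close> returns the bracket minus its average.\<close>
      have "p' t = P (L (L (X t - xbar) + L (xh - X t) - (yh - (Z t + G (X t)))))"
        by (simp add: PL p'_def v_def)
      also have "\<dots> = P (- L yh - L (x' t))"
        unfolding \<open>x' t = - L xh - Z t - G (X t)\<close> by (simp add: lin Lxbar algebra_simps)
      finally have p': "p' t = P (- L yh - L (x' t))" .
      have "((\<lambda>t. q (X t) (Z t)) has_vector_derivative - L yh - L (x' t)) (at t within {a..b})"
        unfolding q_def
        by (auto intro!: derivative_eq_intros Z'[OF t] bounded_linear.has_vector_derivative[OF bounded_linear_L dx])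
      from bounded_linear.has_vector_derivative[OF blP this]
      show "((\<lambda>t. P (q (X t) (Z t))) has_vector_derivative p' t) (at t within {a..b})"
        by (simp add: p')
    qed
    moreover have "V' t \<le> - c * V (X t) (Z t) + (D * S\<^sup>2) * exp (- (2 * c) * t)" if t: "t \<in> {a..b}" for t
    proof -
      obtain \<eta> where \<eta>: "norm (xh - X t) \<le> \<eta>" "norm (yh - (Z t + G (X t))) \<le> 2 * \<eta>"
        "\<eta> \<le> lam * norm (Z t + G (X t)) + S * exp (- c * t)"
        using err[OF t] by blast
      have "V' t \<le> - c * V (X t) (Z t) + D * (S * exp (- c * t))\<^sup>2"
        unfolding V'_def V_def x'_def p'_def
      proof (rule diss[OF _ G_strongly_monotone norm_G_diff_le \<eta>(1,2) _ lam])
        show "norm (P (q (X t) (Z t))) \<le> \<kappa> * norm (L (P (q (X t) (Z t))))"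
          using \<kappa>(2) LP[OF sumq[OF sumZ[OF t]]] by simp
        \<comment> \<open>In shifted coordinates this is the stacked trigger quantity h.\<close>
        have eq: "L (P (q (X t) (Z t))) + L (X t - xbar) + (G (X t) - G xbar) = Z t + G (X t)"
          unfolding LP[OF sumq[OF sumZ[OF t]]] by (simp add: q_def)
        show "\<eta> \<le> lam * norm (L (P (q (X t) (Z t))) + L (X t - xbar) + (G (X t) - G xbar)) + S * exp (- c * t)"
          unfolding eq by (rule \<eta>(3))
        show "P (q (X t) (Z t)) \<bullet> v t = 0"
          unfolding v_def inner_average sumP[OF sumq[OF sumZ[OF t]]] by simp
        show "L (v t) = 0"
          unfolding v_def by (rule laplacian_average)
      qed
      \<comment> \<open>Squaring doubles the rate, producing the forcing that
        \<open>differential_inequality_decay\<close> expects.\<close>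
      also have "(S * exp (- c * t))\<^sup>2 = S\<^sup>2 * exp (- (2 * c) * t)"
        by (simp add: power_mult_distrib flip: exp_double)
      finally show ?thesis
        by (simp add: mult.assoc)
    qed
    ultimately have "exp (c * b) * V (X b) (Z b) + D * S\<^sup>2 / c * exp (- c * b)
        \<le> exp (c * a) * V (X a) (Z a) + D * S\<^sup>2 / c * exp (- c * a)"
      by (rule differential_inequality_decay[OF cD(1) ab])
    then show "(\<Sum>i\<in>UNIV. Z b $ i) = 0 \<and>
      exp (c * b) * V (X b) (Z b) + D * S\<^sup>2 / c * exp (- c * b)
        \<le> exp (c * a) * V (X a) (Z a) + D * S\<^sup>2 / c * exp (- c * a)"
      using sumZ ab by simp
  qed
qed

section \<open>Event-triggered executions\<close>

lemma has_vector_derivative_vec_lambda: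
  fixes g :: "'n::finite \<Rightarrow> real \<Rightarrow> 'a::euclidean_space"
  assumes "\<And>i. (g i has_vector_derivative g' i) (at t within S)"
  shows "((\<lambda>t. \<chi> i. g i t) has_vector_derivative (\<chi> i. g' i)) (at t within S)"
proof -
  define J where "J i v = (\<chi> j. if j = i then v else 0)" for i :: 'n and v :: 'a
  have "linear (J i)" for i
    by (rule linearI) (simp_all add: J_def vec_eq_iff)
  then have J: "bounded_linear (J i)" for i
    by (simp add: linear_conv_bounded_linear)
  have eq: "(\<chi> i. h i) = (\<Sum>i\<in>UNIV. J i (h i))" for h
    by (simp add: J_def vec_eq_iff if_distrib[of "\<lambda>v. v $ _"] cong: if_cong)
  show ?thesis
    unfolding eq by (intro has_vector_derivative_sum bounded_linear.has_vector_derivative[OF J] assms)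
qed

text \<open>The gluing point is extended real because an event time may be infinite; the second
  piece is then empty.\<close>

lemma continuous_on_glue_ereal:
  fixes g :: "real \<Rightarrow> 'a::topological_space"
  assumes "0 \<le> \<sigma>" and "continuous_on {t. 0 \<le> t \<and> ereal t \<le> \<sigma>} g"
    and "continuous_on {t. \<sigma> \<le> ereal t} g"
  shows "continuous_on {0..} g"
proof (cases \<sigma>)
  case (real r)
  then have "{t. 0 \<le> t \<and> ereal t \<le> \<sigma>} = {0..r}" "{t. \<sigma> \<le> ereal t} = {r..}"
    by auto
  then have "continuous_on ({0..r} \<union> {r..}) g"
    using assms by (intro continuous_on_closed_Un) simp_all
  moreover have "{0..r} \<union> {r..} = {0..}"
    using assms(1) real by auto
  ultimately show ?thesis
    by simp
next
  case PInf
  then show ?thesis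
    using assms(2) by (simp add: atLeast_def)
next
  case MInf
  then show ?thesis
    using assms(1) by simp
qed

lemma vector_derivative_bound_imp_lipschitz:
  fixes g :: "real \<Rightarrow> 'a::real_normed_vector"
  assumes "a \<le> b" and "\<And>t. t \<in> {a..b} \<Longrightarrow> (g has_vector_derivative g' t) (at t within {a..b})"
    and "\<And>t. t \<in> {a..b} \<Longrightarrow> norm (g' t) \<le> C"
  shows "norm (g b - g a) \<le> C * (b - a)"
proof -
  have "0 \<le> C"
    using assms(3)[of a] assms(1) by (smt (verit) atLeastAtMost_iff norm_ge_zero)
  have "norm (g b - g a) \<le> C * norm (b - a)"
  proof (rule differentiable_bound)
    show "(g has_derivative (\<lambda>h. h *\<^sub>R g' t)) (at t within {a..b})" if "t \<in> {a..b}" for t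
      using assms(2)[OF that] by (simp add: has_vector_derivative_def)
    show "onorm (\<lambda>h. h *\<^sub>R g' t) \<le> C" if "t \<in> {a..b}" for t
      using assms(3)[OF that] \<open>0 \<le> C\<close>
      by (intro onorm_bound) (simp_all add: mult.commute[of C] mult_left_mono)
  qed (use assms(1) in auto)
  then show ?thesis
    using assms(1) by simp
qed

lemma exponential_ode_unique:
  fixes y :: "real \<Rightarrow> real"
  assumes "\<And>t. 0 \<le> t \<Longrightarrow> (y has_real_derivative - nu * y t) (at t within {0..})" and "0 \<le> t"
  shows "y t = y 0 * exp (- nu * t)"
proof -
  have "((\<lambda>t. y t * exp (nu * t)) has_real_derivative 0) (at t within {0..})" if "t \<in> {0..}" for t
    using that by (auto intro!: derivative_eq_intros assms(1))
  then obtain k where k: "\<And>t. 0 \<le> t \<Longrightarrow> y t * exp (nu * t) = k"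
    using has_field_derivative_zero_constant[of "{0..}" "\<lambda>t. y t * exp (nu * t)"] by auto
  have "y t * exp (nu * t) = y 0"
    using k[of t] k[of 0] assms(2) by simp
  then show ?thesis
    by (simp add: exp_minus field_simps)
qed

text \<open>Names the witnesses of \<open>atgt_execution\<close>. The bound c \<le> nu makes |\<xi>|
  decay at least as fast as exp(-ct).\<close>

locale triggered_execution = tracking_lyapunov f E W \<alpha> \<beta> xstar V c D lamstar
  for f :: "'n::finite \<Rightarrow> real^'d \<Rightarrow> real"
    and E :: "('n \<times> 'n) set" and W :: "real^'n^'n" and \<alpha> \<beta> :: real and xstar :: "real^'d"
    and V :: "real^'d^'n \<Rightarrow> real^'d^'n \<Rightarrow> real" and c D lamstar :: real +
  fixes lam nu :: real and \<xi> :: "'n \<Rightarrow> real \<Rightarrow> real" and s :: "nat \<Rightarrow> ereal"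
    and \<tau> :: "nat \<Rightarrow> 'n \<Rightarrow> real" and X Z :: "nat \<Rightarrow> 'n \<Rightarrow> real \<Rightarrow> real^'d"
  assumes lam: "0 < lam" "lam < lamstar" and nu: "c \<le> nu"
    and \<xi>_ode: "\<And>i t. 0 \<le> t \<Longrightarrow> (\<xi> i has_real_derivative - nu * \<xi> i t) (at t within {0..})"
    and \<xi>0: "\<And>i. \<xi> i 0 \<noteq> 0"
    and s_0: "s 0 = 0" and \<tau>_0: "\<And>i. \<tau> 0 i = 0"
    and held: "\<And>m. held_dynamics E W f (\<tau> m) (X m) (Z m) {t. s m \<le> ereal t}"
    and s_Suc: "\<And>m. s (Suc m) = (INF i. next_trigger f lam (X m) (Z m) \<xi> i (\<tau> m i))"
    and \<tau>_Suc: "\<And>m i. \<tau> (Suc m) i =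
           (if s (Suc m) < \<infinity> \<and> next_trigger f lam (X m) (Z m) \<xi> i (\<tau> m i) = s (Suc m)
            then real_of_ereal (s (Suc m)) else \<tau> m i)"
    and agree: "\<And>m i t. 0 \<le> t \<Longrightarrow> ereal t \<le> s (Suc m) \<Longrightarrow>
           X (Suc m) i t = X m i t \<and> Z (Suc m) i t = Z m i t"
    and sum_Z0: "(\<Sum>i\<in>UNIV. Z 0 i 0) = 0"
begin

section \<open>Event times and the trigger condition along held trajectories\<close>

lemma \<xi>_eq: "0 \<le> t \<Longrightarrow> \<xi> i t = \<xi> i 0 * exp (- nu * t)"
  by (rule exponential_ode_unique[OF \<xi>_ode])

lemma abs_\<xi>_eq: "0 \<le> t \<Longrightarrow> \<bar>\<xi> i t\<bar> = \<bar>\<xi> i 0\<bar> * exp (- nu * t)"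
  by (simp add: \<xi>_eq[of t i] abs_mult)

lemma s_Suc_le: "s (Suc m) \<le> next_trigger f lam (X m) (Z m) \<xi> i (\<tau> m i)"
  unfolding s_Suc by (rule INF_lower) simp

text \<open>Monotonicity of \<open>s\<close> is the substantial part. If the continuation after
  event \<open>Suc m\<close> had a trigger before \<open>s (Suc m)\<close>, the previous trajectory,
  which agrees with it there, would have the same trigger, contradicting the infimum.\<close>

lemma event_order: "0 \<le> \<tau> m i \<and> ereal (\<tau> m i) \<le> s m \<and> s m \<le> s (Suc m)"
proof (induction m arbitrary: i)
  case 0
  have "0 \<le> next_trigger f lam (X 0) (Z 0) \<xi> i (\<tau> 0 i)" for i
    unfolding next_trigger_def by (intro Inf_greatest) (auto simp: \<tau>_0)
  then show ?case
    by (auto simp: s_0 \<tau>_0 s_Suc zero_ereal_def intro: INF_greatest)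
next
  case (Suc m)
  have nonneg: "0 \<le> s (Suc m)"
    using Suc order_trans by (metis ereal_less_eq(5))
  have \<tau>: "0 \<le> \<tau> (Suc m) i \<and> ereal (\<tau> (Suc m) i) \<le> s (Suc m)" for i
  proof (cases "s (Suc m) < \<infinity> \<and> next_trigger f lam (X m) (Z m) \<xi> i (\<tau> m i) = s (Suc m)")
    case True
    then show ?thesis
      using nonneg by (cases "s (Suc m)") (simp_all add: \<tau>_Suc)
  next
    case False
    then have "\<tau> (Suc m) i = \<tau> m i"
      unfolding \<tau>_Suc by (rule if_not_P)
    then show ?thesis
      using Suc[of i] order_trans by metis
  qed
  have "s (Suc m) \<le> next_trigger f lam (X (Suc m)) (Z (Suc m)) \<xi> i (\<tau> (Suc m) i)" for i
    unfolding next_trigger_def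
  proof (rule Inf_greatest, rule ccontr)
    fix u
    assume "u \<in> ereal ` {t. \<tau> (Suc m) i < t \<and> trigger_condition f lam (X (Suc m)) (Z (Suc m)) \<xi> i (\<tau> (Suc m) i) t}"
      and u: "\<not> s (Suc m) \<le> u"
    then obtain t where t: "u = ereal t" "\<tau> (Suc m) i < t"
      "trigger_condition f lam (X (Suc m)) (Z (Suc m)) \<xi> i (\<tau> (Suc m) i) t"
      by blast
    have ts: "ereal t < s (Suc m)"
      using u t(1) by simp
    \<comment> \<open>An agent that had just broadcast would have \<open>\<tau> (Suc m) i\<close>
      equal to \<open>s (Suc m)\<close>, later than t.\<close>
    have "\<tau> (Suc m) i = \<tau> m i"
    proof (rule ccontr)
      assume "\<tau> (Suc m) i \<noteq> \<tau> m i"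
      then have "s (Suc m) < \<infinity>" "\<tau> (Suc m) i = real_of_ereal (s (Suc m))"
        unfolding \<tau>_Suc by (auto split: if_splits)
      then have "ereal (\<tau> (Suc m) i) = s (Suc m)"
        using nonneg by (cases "s (Suc m)") simp_all
      then show False
        using ts t(2) by (metis less_ereal.simps(1) less_asym)
    qed
    moreover have "X (Suc m) i t = X m i t \<and> Z (Suc m) i t = Z m i t"
      using \<tau>[of i] t(2) ts by (intro agree) auto
    moreover have "X (Suc m) i (\<tau> (Suc m) i) = X m i (\<tau> (Suc m) i) \<and> Z (Suc m) i (\<tau> (Suc m) i) = Z m i (\<tau> (Suc m) i)"
      using \<tau>[of i] by (intro agree) auto
    ultimately have "trigger_condition f lam (X m) (Z m) \<xi> i (\<tau> m i) t" "\<tau> m i < t"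
      using t unfolding trigger_condition_def by metis+
    then have "next_trigger f lam (X m) (Z m) \<xi> i (\<tau> m i) \<le> ereal t"
      unfolding next_trigger_def by (intro Inf_lower) blast
    then show False
      using s_Suc_le[of m i] ts by (meson leD order_trans)
  qed
  then have "s (Suc m) \<le> s (Suc (Suc m))"
    unfolding s_Suc[of "Suc m"] by (intro INF_greatest)
  with \<tau> show ?case
    by blast
qed

lemma \<tau>_nonneg: "0 \<le> \<tau> m i" and \<tau>_le_s: "ereal (\<tau> m i) \<le> s m" and s_le_Suc: "s m \<le> s (Suc m)"
  using event_order by blast+

lemma incseq_s: "incseq s"
  by (simp add: incseq_SucI s_le_Suc)

lemma s_nonneg: "0 \<le> s m"
  using incseq_s s_0 by (metis incseqD le0)

lemma s_finite_cases:
  obtains r where "s m = ereal r" "0 \<le> r" | "s m = \<infinity>"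
  using s_nonneg[of m] by (cases "s m") auto

text \<open>The differential equation gives continuity from \<open>s m\<close> on; the history
  before \<open>s m\<close> is inherited from the previous trajectory, and both are glued at
  \<open>s m\<close>.\<close>

lemma continuous_X: "continuous_on {0..} (X m i)" and continuous_Z: "continuous_on {0..} (Z m i)"
proof -
  have tail: "continuous_on {t. s m \<le> ereal t} (X m i) \<and> continuous_on {t. s m \<le> ereal t} (Z m i)" for m
    using held[of m] unfolding held_dynamics_def Let_def
    by (intro conjI; intro continuous_on_vector_derivative) blast+
  have "continuous_on {t. 0 \<le> t \<and> ereal t \<le> s m} (X m i) \<and> continuous_on {t. 0 \<le> t \<and> ereal t \<le> s m} (Z m i)"
  proof (induction m)
    case 0
    have "{t. 0 \<le> t \<and> ereal t \<le> s 0} = {0}"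
      by (auto simp: s_0 zero_ereal_def)
    then show ?case
      by simp
  next
    case (Suc m)
    have "continuous_on {0..} (X m i)" "continuous_on {0..} (Z m i)"
      using Suc tail s_nonneg by (auto intro: continuous_on_glue_ereal)
    then have "continuous_on {t. 0 \<le> t \<and> ereal t \<le> s (Suc m)} (X m i)"
      "continuous_on {t. 0 \<le> t \<and> ereal t \<le> s (Suc m)} (Z m i)"
      by (auto elim: continuous_on_subset)
    then show ?case
    proof (intro conjI)
      show "continuous_on {t. 0 \<le> t \<and> ereal t \<le> s (Suc m)} (X (Suc m) i)"
        if "continuous_on {t. 0 \<le> t \<and> ereal t \<le> s (Suc m)} (X m i)"
        by (rule continuous_on_eq[OF that]) (simp add: agree)
      show "continuous_on {t. 0 \<le> t \<and> ereal t \<le> s (Suc m)} (Z (Suc m) i)"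
        if "continuous_on {t. 0 \<le> t \<and> ereal t \<le> s (Suc m)} (Z m i)"
        by (rule continuous_on_eq[OF that]) (simp add: agree)
    qed
  qed
  then show "continuous_on {0..} (X m i)" "continuous_on {0..} (Z m i)"
    using tail s_nonneg by (auto intro: continuous_on_glue_ereal)
qed

definition err :: "nat \<Rightarrow> 'n \<Rightarrow> real \<Rightarrow> (real^'d) \<times> (real^'d) \<times> (real^'d)" where
  "err m i t = (X m i t - X m i (\<tau> m i), Z m i t - Z m i (\<tau> m i),
     grad (f i) (X m i t) - grad (f i) (X m i (\<tau> m i)))"

definition excess :: "nat \<Rightarrow> 'n \<Rightarrow> real \<Rightarrow> real" where
  "excess m i t = norm (err m i t) - (lam * norm (Z m i t + grad (f i) (X m i t)) + \<bar>\<xi> i t\<bar>)"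

lemma trigger_iff_excess: "trigger_condition f lam (X m) (Z m) \<xi> i (\<tau> m i) t \<longleftrightarrow> 0 < excess m i t"
  by (auto simp: trigger_condition_def excess_def err_def)

lemma continuous_excess: "continuous_on {0..} (excess m i)"
proof -
  have "continuous_on UNIV (grad (f i))"
    by (rule lipschitz_on_continuous_on[OF grad_lipschitz])
  then have "continuous_on {0..} (\<lambda>t. grad (f i) (X m i t))"
    by (rule continuous_on_compose2[OF _ continuous_X]) simp
  moreover have "continuous_on {0..} (\<xi> i)"
    using \<xi>_ode by (auto intro!: DERIV_continuous_on)
  ultimately show ?thesis
    unfolding excess_def err_def
    using continuous_X[of m i] continuous_Z[of m i] by (intro continuous_intros)
qed

text \<open>A positive excess persists slightly to the left by continuity, giving a trigger strictly
  before \<open>s (Suc m)\<close>. This covers the event instant itself as well.\<close>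

lemma excess_nonpos:
  assumes "\<tau> m i \<le> t" "ereal t \<le> s (Suc m)"
  shows "excess m i t \<le> 0"
proof (rule ccontr)
  assume "\<not> excess m i t \<le> 0"
  then have pos: "0 < excess m i t"
    by simp
  moreover have "excess m i (\<tau> m i) \<le> 0"
  proof -
    have "0 \<le> lam * norm (Z m i (\<tau> m i) + grad (f i) (X m i (\<tau> m i))) + \<bar>\<xi> i (\<tau> m i)\<bar>"
      using lam by (intro add_nonneg_nonneg) auto
    then show ?thesis
      unfolding excess_def err_def by (simp only: diff_self zero_prod_def[symmetric] norm_zero diff_0 neg_le_0_iff_le)
  qed
  ultimately have less: "\<tau> m i < t"
    using assms(1) by (metis leD order_le_imp_less_or_eq)
  have t: "0 \<le> t"
    using \<tau>_nonneg assms(1) order_trans by blast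
  obtain d where d: "0 < d" "\<And>u. 0 \<le> u \<Longrightarrow> dist u t < d \<Longrightarrow> dist (excess m i u) (excess m i t) < excess m i t"
    using continuous_excess[of m i] t pos unfolding continuous_on_iff by (metis atLeast_iff)
  \<comment> \<open>A point after the last broadcast, before t, and within the continuity
    radius.\<close>
  define u where "u = max ((\<tau> m i + t) / 2) (t - d / 2)"
  have u: "\<tau> m i < u" "u < t" "dist u t < d"
    using less d(1) by (auto simp: u_def dist_real_def less_max_iff_disj)
  then have "0 < excess m i u"
    using d(2)[of u] \<tau>_nonneg[of m i] by (simp add: dist_real_def)
  then have "next_trigger f lam (X m) (Z m) \<xi> i (\<tau> m i) \<le> ereal u"
    unfolding next_trigger_def using u(1) by (intro Inf_lower) (auto simp: trigger_iff_excess)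
  then have "s (Suc m) \<le> ereal u"
    using s_Suc_le order_trans by blast
  then show False
    using assms(2) u(2) by (metis ereal_less_eq(3) leD order_trans)
qed

text \<open>The trigger inequality is strict, so its infimum need not satisfy it; but triggers exist
  arbitrarily close to the right of r, and continuity yields the weak inequality at r.\<close>

lemma excess_nonneg_at_trigger:
  assumes "next_trigger f lam (X m) (Z m) \<xi> i (\<tau> m i) = ereal r"
  shows "0 \<le> excess m i r"
proof (rule ccontr)
  assume "\<not> 0 \<le> excess m i r"
  then have neg: "excess m i r < 0"
    by simp
  have "ereal (\<tau> m i) \<le> ereal r"
    unfolding assms[symmetric] next_trigger_def by (intro Inf_greatest) auto
  then have r: "0 \<le> r"
    using \<tau>_nonneg[of m i] by simp
  obtain d where d: "0 < d" "\<And>u. 0 \<le> u \<Longrightarrow> dist u r < d \<Longrightarrow> dist (excess m i u) (excess m i r) < - excess m i r"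
    using continuous_excess[of m i] r neg unfolding continuous_on_iff by (metis atLeast_iff neg_0_less_iff_less)
  have "next_trigger f lam (X m) (Z m) \<xi> i (\<tau> m i) < ereal (r + d)"
    using assms d(1) by simp
  then obtain u where u: "u < r + d" "\<tau> m i < u" "0 < excess m i u"
    unfolding next_trigger_def Inf_less_iff by (auto simp: trigger_iff_excess)
  then have "next_trigger f lam (X m) (Z m) \<xi> i (\<tau> m i) \<le> ereal u"
    unfolding next_trigger_def by (intro Inf_lower) (auto simp: trigger_iff_excess)
  then have "r \<le> u"
    using assms by simp
  then show False
    using d(2)[of u] u r by (auto simp: dist_real_def)
qed

end

text \<open>Neighbor sums become full sums as weights vanish off the graph; the two sums of the z
  equation merge into one Laplacian acting on the held z + \<nabla>f.\<close>

lemma held_dynamics_stacked: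
  fixes f :: "'n::finite \<Rightarrow> real^'d \<Rightarrow> real"
  assumes adj: "weighted_adjacency E W" and held: "held_dynamics E W f \<tau> x z I" and t: "t \<in> I"
  shows "((\<lambda>t. \<chi> i. x i t) has_vector_derivative
      - laplacian W (\<chi> i. x i (\<tau> i)) - (\<chi> i. z i t) - (\<chi> i. grad (f i) (x i t))) (at t within I)"
    and "((\<lambda>t. \<chi> i. z i t) has_vector_derivative
      - laplacian W (\<chi> i. z i (\<tau> i) + grad (f i) (x i (\<tau> i)))) (at t within I)"
proof -
  have sum_nb: "(\<Sum>j\<in>neighbors E i. W $ i $ j *\<^sub>R v j) = (\<Sum>j\<in>UNIV. W $ i $ j *\<^sub>R v j)"
    for i and v :: "'n \<Rightarrow> real^'d"
  proof (rule sum.mono_neutral_left)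
    show "\<forall>j\<in>UNIV - neighbors E i. W $ i $ j *\<^sub>R v j = 0"
    proof
      fix j
      assume "j \<in> UNIV - neighbors E i"
      then have "(i, j) \<notin> E"
        by (simp add: neighbors_def)
      moreover have "if (i, j) \<in> E then 0 < W $ i $ j else W $ i $ j = 0"
        using adj by (simp add: weighted_adjacency_def)
      ultimately show "W $ i $ j *\<^sub>R v j = 0"
        by simp
    qed
  qed auto
  have dx: "(x i has_vector_derivative
      - (\<Sum>j\<in>neighbors E i. (W $ i $ j) *\<^sub>R (x i (\<tau> i) - x j (\<tau> j))) - z i t - grad (f i) (x i t)) (at t within I)"
    and dz: "(z i has_vector_derivative
      - (\<Sum>j\<in>neighbors E i. (W $ i $ j) *\<^sub>R (z i (\<tau> i) - z j (\<tau> j)))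
      - (\<Sum>j\<in>neighbors E i. (W $ i $ j) *\<^sub>R (grad (f i) (x i (\<tau> i)) - grad (f j) (x j (\<tau> j))))) (at t within I)"
    for i
    using held t unfolding held_dynamics_def Let_def by blast+
  have "- laplacian W (\<chi> i. x i (\<tau> i)) - (\<chi> i. z i t) - (\<chi> i. grad (f i) (x i t)) =
      (\<chi> i. - (\<Sum>j\<in>neighbors E i. (W $ i $ j) *\<^sub>R (x i (\<tau> i) - x j (\<tau> j))) - z i t - grad (f i) (x i t))"
    by (simp add: vec_eq_iff laplacian_def sum_nb)
  then show "((\<lambda>t. \<chi> i. x i t) has_vector_derivative
      - laplacian W (\<chi> i. x i (\<tau> i)) - (\<chi> i. z i t) - (\<chi> i. grad (f i) (x i t))) (at t within I)"
    using has_vector_derivative_vec_lambda[OF dx] by simp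
  have "- laplacian W (\<chi> i. z i (\<tau> i) + grad (f i) (x i (\<tau> i))) =
      (\<chi> i. - (\<Sum>j\<in>neighbors E i. (W $ i $ j) *\<^sub>R (z i (\<tau> i) - z j (\<tau> j)))
      - (\<Sum>j\<in>neighbors E i. (W $ i $ j) *\<^sub>R (grad (f i) (x i (\<tau> i)) - grad (f j) (x j (\<tau> j)))))"
  proof -
    have split: "(\<Sum>j\<in>UNIV. W $ i $ j *\<^sub>R (u i + v i - (u j + v j))) =
        (\<Sum>j\<in>UNIV. W $ i $ j *\<^sub>R (u i - u j)) + (\<Sum>j\<in>UNIV. W $ i $ j *\<^sub>R (v i - v j))"
      for i and u v :: "'n \<Rightarrow> real^'d"
      by (simp only: sum.distrib[symmetric] scaleR_right_distrib[symmetric] add_diff_add)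
    show ?thesis
      unfolding sum_nb vec_eq_iff
      using split[of _ "\<lambda>i. z i (\<tau> i)" "\<lambda>i. grad (f i) (x i (\<tau> i))"]
      by (simp only: laplacian_def vec_lambda_beta vector_uminus_component minus_add_distrib
          diff_conv_add_uminus simp_thms)
  qed
  then show "((\<lambda>t. \<chi> i. z i t) has_vector_derivative
      - laplacian W (\<chi> i. z i (\<tau> i) + grad (f i) (x i (\<tau> i)))) (at t within I)"
    using has_vector_derivative_vec_lambda[OF dz] by simp
qed

section \<open>Exponential decay across events\<close>

context triggered_execution
begin

definition XX :: "nat \<Rightarrow> real \<Rightarrow> real^'d^'n" where
  "XX m t = (\<chi> i. X m i t)"

definition ZZ :: "nat \<Rightarrow> real \<Rightarrow> real^'d^'n" where
  "ZZ m t = (\<chi> i. Z m i t)"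

definition XH :: "nat \<Rightarrow> real^'d^'n" where
  "XH m = (\<chi> i. X m i (\<tau> m i))"

definition YH :: "nat \<Rightarrow> real^'d^'n" where
  "YH m = (\<chi> i. Z m i (\<tau> m i) + grad (f i) (X m i (\<tau> m i)))"

lemma agree_stacked: "0 \<le> t \<Longrightarrow> ereal t \<le> s (Suc m) \<Longrightarrow> XX (Suc m) t = XX m t \<and> ZZ (Suc m) t = ZZ m t"
  by (simp add: XX_def ZZ_def agree)

lemma stacked_derivative:
  assumes "s m \<le> ereal a" "t \<in> {a..b}"
  shows "(XX m has_vector_derivative - L (XH m) - ZZ m t - G (XX m t)) (at t within {a..b})"
    and "(ZZ m has_vector_derivative - L (YH m)) (at t within {a..b})"
proof -
  have sub: "{a..b} \<subseteq> {t. s m \<le> ereal t}"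
    using assms(1) order_trans by fastforce
  then have "t \<in> {t. s m \<le> ereal t}"
    using assms(2) by blast
  note d = held_dynamics_stacked[OF adjacency held this]
  show "(XX m has_vector_derivative - L (XH m) - ZZ m t - G (XX m t)) (at t within {a..b})"
    using has_vector_derivative_within_subset[OF d(1) sub]
    by (simp add: XX_def[abs_def] ZZ_def XH_def G_def)
  show "(ZZ m has_vector_derivative - L (YH m)) (at t within {a..b})"
    using has_vector_derivative_within_subset[OF d(2) sub] by (simp add: ZZ_def[abs_def] YH_def)
qed

definition \<xi>_norm :: real where
  "\<xi>_norm = L2_set (\<lambda>i. \<bar>\<xi> i 0\<bar>) UNIV"

text \<open>Here \<eta> is the Euclidean norm of the agentwise thresholds. The factor 2 arises
  because the error of z + \<nabla>f combines two components of \<open>err\<close>, each bounded by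
  its norm; the triangle inequality in \<open>L2_set\<close> separates the h part from the \<xi>
  part.\<close>

lemma stacked_error_bound:
  assumes "0 \<le> t" "s m \<le> ereal t" "ereal t \<le> s (Suc m)"
  shows "\<exists>\<eta>. norm (XH m - XX m t) \<le> \<eta> \<and> norm (YH m - (ZZ m t + G (XX m t))) \<le> 2 * \<eta> \<and>
    \<eta> \<le> lam * norm (ZZ m t + G (XX m t)) + \<xi>_norm * exp (- c * t)"
proof -
  define h where "h i = norm (Z m i t + grad (f i) (X m i t))" for i
  define \<eta> where "\<eta> = L2_set (\<lambda>i. lam * h i + \<bar>\<xi> i t\<bar>) UNIV"
  have "\<tau> m i \<le> t" for i
    using \<tau>_le_s[of m i] assms(2) order_trans by (metis ereal_less_eq(3))
  then have e: "norm (err m i t) \<le> lam * h i + \<bar>\<xi> i t\<bar>" for i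
    using excess_nonpos[of m i t] assms(3) by (simp add: excess_def h_def)
  have "norm ((XH m - XX m t) $ i) \<le> lam * h i + \<bar>\<xi> i t\<bar>" for i
  proof -
    have "norm (X m i t - X m i (\<tau> m i)) \<le> norm (err m i t)"
      unfolding err_def by (rule norm_fst_le)
    then show ?thesis
      using e[of i] by (simp add: XH_def XX_def norm_minus_commute)
  qed
  then have "norm (XH m - XX m t) \<le> \<eta>"
    unfolding \<eta>_def norm_vec_def[of "XH m - XX m t"] by (intro L2_set_mono) auto
  moreover have "norm (YH m - (ZZ m t + G (XX m t))) \<le> 2 * \<eta>"
  proof -
    have "norm ((YH m - (ZZ m t + G (XX m t))) $ i) \<le> 2 * (lam * h i + \<bar>\<xi> i t\<bar>)" for i
    proof -
      have a: "norm (Z m i t - Z m i (\<tau> m i)) \<le> norm (err m i t)"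
        "norm (grad (f i) (X m i t) - grad (f i) (X m i (\<tau> m i))) \<le> norm (err m i t)"
        unfolding err_def
        by (rule order_trans[OF norm_fst_le norm_snd_le], rule order_trans[OF norm_snd_le norm_snd_le])
      have "(YH m - (ZZ m t + G (XX m t))) $ i =
          - ((Z m i t - Z m i (\<tau> m i)) + (grad (f i) (X m i t) - grad (f i) (X m i (\<tau> m i))))"
        by (simp add: YH_def ZZ_def G_def XX_def)
      then have "norm ((YH m - (ZZ m t + G (XX m t))) $ i) \<le>
          norm (Z m i t - Z m i (\<tau> m i)) + norm (grad (f i) (X m i t) - grad (f i) (X m i (\<tau> m i)))"
        by (simp only: norm_minus_cancel norm_triangle_ineq)
      then show ?thesis
        using a e[of i] by argo
    qed
    then have "norm (YH m - (ZZ m t + G (XX m t))) \<le> L2_set (\<lambda>i. 2 * (lam * h i + \<bar>\<xi> i t\<bar>)) UNIV"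
      unfolding norm_vec_def[of "YH m - (ZZ m t + G (XX m t))"] by (intro L2_set_mono) auto
    then show ?thesis
      by (simp only: \<eta>_def L2_set_right_distrib)
  qed
  moreover have "\<eta> \<le> lam * norm (ZZ m t + G (XX m t)) + \<xi>_norm * exp (- c * t)"
  proof -
    have "\<eta> \<le> L2_set (\<lambda>i. lam * h i) UNIV + L2_set (\<lambda>i. \<bar>\<xi> i t\<bar>) UNIV"
      unfolding \<eta>_def by (rule L2_set_triangle_ineq)
    also have "L2_set (\<lambda>i. lam * h i) UNIV = lam * norm (ZZ m t + G (XX m t))"
      unfolding norm_vec_def[of "ZZ m t + G (XX m t)"] unfolding h_def ZZ_def G_def XX_def
      by (simp only: vector_add_component vec_lambda_beta L2_set_right_distrib[OF less_imp_le[OF lam(1)]])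
    also have "L2_set (\<lambda>i. \<bar>\<xi> i t\<bar>) UNIV \<le> L2_set (\<lambda>i. \<bar>\<xi> i 0\<bar> * exp (- c * t)) UNIV"
    proof (rule L2_set_mono)
      show "\<bar>\<xi> i t\<bar> \<le> \<bar>\<xi> i 0\<bar> * exp (- c * t)" for i
        unfolding abs_\<xi>_eq[OF assms(1)] using nu assms(1) by (intro mult_left_mono) (auto intro: mult_right_mono)
    qed simp
    also have "L2_set (\<lambda>i. \<bar>\<xi> i 0\<bar> * exp (- c * t)) UNIV = \<xi>_norm * exp (- c * t)"
      by (simp add: \<xi>_norm_def L2_set_left_distrib)
    finally show ?thesis
      by simp
  qed
  ultimately show ?thesis
    by blast
qed

text \<open>Initial value of the quantity in \<open>lyapunov_decay\<close>. It depends on the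
  initial data but not on \<open>lam\<close> or \<open>nu\<close>, hence so does the final
  constant.\<close>

definition level :: real where
  "level = V (XX 0 0) (ZZ 0 0) + D * \<xi>_norm\<^sup>2 / c"

text \<open>Up to \<open>s (Suc m)\<close> the new trajectory repeats the old one; beyond it,
  \<open>lyapunov_decay\<close> applies with the new held data, starting from the value at that
  event.\<close>

lemma decay_invariant:
  assumes "0 \<le> t" "ereal t \<le> s (Suc m)"
  shows "(\<Sum>i\<in>UNIV. ZZ m t $ i) = 0 \<and>
    exp (c * t) * V (XX m t) (ZZ m t) + D * \<xi>_norm\<^sup>2 / c * exp (- c * t) \<le> level"
  using assms
proof (induction m arbitrary: t)
  case 0
  have "(\<Sum>i\<in>UNIV. ZZ 0 t $ i) = 0 \<and>
      exp (c * t) * V (XX 0 t) (ZZ 0 t) + D * \<xi>_norm\<^sup>2 / c * exp (- c * t)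
      \<le> exp (c * 0) * V (XX 0 0) (ZZ 0 0) + D * \<xi>_norm\<^sup>2 / c * exp (- c * 0)"
  proof (rule lyapunov_decay[where X = "XX 0" and Z = "ZZ 0" and xh = "XH 0" and yh = "YH 0", OF 0(1) _ _ _ _ less_imp_le[OF lam(1)] lam(2)])
    show "(\<Sum>i\<in>UNIV. ZZ 0 0 $ i) = 0"
      using sum_Z0 by (simp add: ZZ_def)
    fix u
    assume u: "u \<in> {0..t}"
    then show "\<exists>\<eta>. norm (XH 0 - XX 0 u) \<le> \<eta> \<and> norm (YH 0 - (ZZ 0 u + G (XX 0 u))) \<le> 2 * \<eta> \<and>
      \<eta> \<le> lam * norm (ZZ 0 u + G (XX 0 u)) + \<xi>_norm * exp (- c * u)"
      using 0 order_trans[of "ereal u" "ereal t"] by (intro stacked_error_bound) (auto simp: s_0)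
  qed (use stacked_derivative[of 0 0] in \<open>auto simp: s_0\<close>)
  then show ?case
    by (simp add: level_def)
next
  case (Suc m)
  show ?case
  proof (cases "ereal t \<le> s (Suc m)")
    case True
    then show ?thesis
      using Suc.IH[of t] Suc.prems(1) agree_stacked[of t m] by simp
  next
    case False
    obtain a where a: "s (Suc m) = ereal a" "0 \<le> a"
      using False by (cases rule: s_finite_cases[of "Suc m"]) auto
    have at: "a \<le> t"
      using False a by simp
    have IH: "(\<Sum>i\<in>UNIV. ZZ (Suc m) a $ i) = 0 \<and>
        exp (c * a) * V (XX (Suc m) a) (ZZ (Suc m) a) + D * \<xi>_norm\<^sup>2 / c * exp (- c * a) \<le> level"
      using Suc.IH[of a] a agree_stacked[of a m] by simp
    have "(\<Sum>i\<in>UNIV. ZZ (Suc m) t $ i) = 0 \<and>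
        exp (c * t) * V (XX (Suc m) t) (ZZ (Suc m) t) + D * \<xi>_norm\<^sup>2 / c * exp (- c * t)
        \<le> exp (c * a) * V (XX (Suc m) a) (ZZ (Suc m) a) + D * \<xi>_norm\<^sup>2 / c * exp (- c * a)"
    proof (rule lyapunov_decay[where X = "XX (Suc m)" and Z = "ZZ (Suc m)" and xh = "XH (Suc m)" and yh = "YH (Suc m)", OF at conjunct1[OF IH] _ _ _ less_imp_le[OF lam(1)] lam(2)])
      fix u
      assume u: "u \<in> {a..t}"
      then show "\<exists>\<eta>. norm (XH (Suc m) - XX (Suc m) u) \<le> \<eta> \<and>
        norm (YH (Suc m) - (ZZ (Suc m) u + G (XX (Suc m) u))) \<le> 2 * \<eta> \<and>
        \<eta> \<le> lam * norm (ZZ (Suc m) u + G (XX (Suc m) u)) + \<xi>_norm * exp (- c * u)"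
        using Suc.prems a order_trans[of "ereal u" "ereal t"] by (intro stacked_error_bound) auto
    qed (use stacked_derivative[of "Suc m" a] a in auto)
    with IH show ?thesis
      by linarith
  qed
qed

lemma V_decay:
  assumes "0 \<le> t" "ereal t \<le> s (Suc m)"
  shows "V (XX m t) (ZZ m t) \<le> level * exp (- c * t)"
proof -
  have "0 \<le> D * \<xi>_norm\<^sup>2 / c * exp (- c * t)"
    using D_pos c_pos by simp
  then have "exp (c * t) * V (XX m t) (ZZ m t) \<le> level"
    using decay_invariant[OF assms] by linarith
  from mult_right_mono[OF this, of "exp (- c * t)"] show ?thesis
    by (simp add: mult.assoc mult.commute[of "V _ _"] exp_minus field_simps)
qed

lemma level_nonneg: "0 \<le> level"
proof -
  have "0 \<le> 4 * V (XX 0 0) (ZZ 0 0)"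
    using zero_le_power2 norm_error_le by (rule order_trans)
  moreover have "0 \<le> D * \<xi>_norm\<^sup>2 / c"
    using D_pos c_pos by simp
  ultimately show ?thesis
    by (simp add: level_def)
qed

section \<open>Uniform bounds and exclusion of accumulating events\<close>

lemma state_bounded:
  obtains B where "0 < B" "\<And>m t. 0 \<le> t \<Longrightarrow> ereal t \<le> s (Suc m) \<Longrightarrow> norm (XX m t) \<le> B \<and> norm (ZZ m t) \<le> B"
proof -
  obtain B where B: "0 < B"
    "\<And>x z. (\<Sum>i\<in>UNIV. z $ i) = 0 \<Longrightarrow> V x z \<le> level \<Longrightarrow> norm x \<le> B \<and> norm z \<le> B"
    using sublevel_bounded[of level] by blast
  show thesis
  proof (rule that[OF B(1)])
    fix m and t :: real
    assume t: "0 \<le> t" "ereal t \<le> s (Suc m)"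
    have "level * exp (- c * t) \<le> level * 1"
      using t(1) c_pos level_nonneg by (intro mult_left_mono) auto
    then show "norm (XX m t) \<le> B \<and> norm (ZZ m t) \<le> B"
      using V_decay[OF t] decay_invariant[OF t] by (intro B(2)) auto
  qed
qed

text \<open>Held values of different agents stem from different instants, so they do not form one
  state of the trajectory; they are bounded agent by agent and stacked at the cost of a factor
  N.\<close>

lemma norm_le_card_mult:
  fixes v :: "real^'d^'n"
  assumes "\<And>i. norm (v $ i) \<le> B"
  shows "norm v \<le> real CARD('n) * B"
proof -
  have "norm v \<le> (\<Sum>i\<in>UNIV. norm (v $ i))"
    unfolding norm_vec_def[of v] by (rule L2_set_le_sum) simp
  also have "\<dots> \<le> real CARD('n) * B"
    using sum_mono[of UNIV "\<lambda>i. norm (v $ i)" "\<lambda>_. B"] assms by simp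
  finally show ?thesis .
qed

text \<open>Bounded states and bounded held data bound the velocities by one constant for all m;
  increments before and after an event time inside [t, u] are added.\<close>

lemma state_lipschitz:
  obtains C where "0 < C" "\<And>m t u. 0 \<le> t \<Longrightarrow> t \<le> u \<Longrightarrow> ereal u \<le> s (Suc m) \<Longrightarrow>
    norm (XX m u - XX m t) \<le> C * (u - t) \<and> norm (ZZ m u - ZZ m t) \<le> C * (u - t)"
proof -
  obtain B where B: "0 < B"
    "\<And>m t. 0 \<le> t \<Longrightarrow> ereal t \<le> s (Suc m) \<Longrightarrow> norm (XX m t) \<le> B \<and> norm (ZZ m t) \<le> B"
    using state_bounded by blast
  obtain l where l: "0 < l" "\<And>x. norm (L x) \<le> l * norm x"
    using L_bound by blast
  define \<Gamma> where "\<Gamma> = \<beta> * B + norm (G 0)"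
  have \<Gamma>: "0 \<le> \<Gamma>"
    using B \<beta>_pos by (simp add: \<Gamma>_def)
  have G_le: "norm (G (XX m t)) \<le> \<Gamma>" if "0 \<le> t" "ereal t \<le> s (Suc m)" for m t
  proof -
    have "norm (G (XX m t) - G 0) \<le> \<beta> * B"
      using order_trans[OF norm_G_diff_le[of "XX m t" 0] mult_left_mono[of _ B]] B(2)[OF that] \<beta>_pos by simp
    then show ?thesis
      using norm_triangle_sub[of "G (XX m t)" "G 0"] by (simp add: \<Gamma>_def)
  qed
  define N where "N = real CARD('n)"
  define C where "C = l * (N * (B + \<Gamma>)) + B + \<Gamma>"
  have N: "0 < N"
    by (simp add: N_def)
  have C: "0 < C"
    unfolding C_def using l(1) N B(1) \<Gamma> by (intro add_pos_nonneg add_nonneg_pos) auto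
  have held_bound: "norm (X m i (\<tau> m i)) \<le> B + \<Gamma> \<and> norm (Z m i (\<tau> m i) + grad (f i) (X m i (\<tau> m i))) \<le> B + \<Gamma>" for m i
  proof -
    have \<tau>: "0 \<le> \<tau> m i" "ereal (\<tau> m i) \<le> s (Suc m)"
      using \<tau>_nonneg \<tau>_le_s s_le_Suc order_trans by blast+
    have "norm (X m i (\<tau> m i)) \<le> B" "norm (Z m i (\<tau> m i)) \<le> B"
      using B(2)[OF \<tau>] Finite_Cartesian_Product.norm_nth_le[of "XX m (\<tau> m i)" i] Finite_Cartesian_Product.norm_nth_le[of "ZZ m (\<tau> m i)" i]
      by (simp_all add: XX_def ZZ_def)
    moreover have "norm (grad (f i) (X m i (\<tau> m i))) \<le> \<Gamma>"
      using G_le[OF \<tau>] Finite_Cartesian_Product.norm_nth_le[of "G (XX m (\<tau> m i))" i] by (simp add: G_def XX_def)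
    ultimately show ?thesis
      using \<Gamma> norm_triangle_ineq[of "Z m i (\<tau> m i)" "grad (f i) (X m i (\<tau> m i))"] by linarith
  qed
  have L_held: "norm (L v) \<le> l * (N * (B + \<Gamma>))" if "\<And>i. norm (v $ i) \<le> B + \<Gamma>" for v
    using order_trans[OF l(2) mult_left_mono[OF norm_le_card_mult[OF that]]] l(1) by (simp add: N_def)
  have LX: "norm (L (XH m)) \<le> l * (N * (B + \<Gamma>))" and LY: "norm (L (YH m)) \<le> l * (N * (B + \<Gamma>))" for m
    using held_bound by (auto intro!: L_held simp: XH_def YH_def)
  have piece: "norm (XX m u - XX m t) \<le> C * (u - t) \<and> norm (ZZ m u - ZZ m t) \<le> C * (u - t)"
    if "0 \<le> t" "t \<le> u" "s m \<le> ereal t" "ereal u \<le> s (Suc m)" for m t u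
  proof
    have in_range: "0 \<le> r" "ereal r \<le> s (Suc m)" if "r \<in> {t..u}" for r
      using that \<open>0 \<le> t\<close> \<open>ereal u \<le> s (Suc m)\<close> order_trans[of "ereal r" "ereal u"] by auto
    show "norm (XX m u - XX m t) \<le> C * (u - t)"
    proof (rule vector_derivative_bound_imp_lipschitz[OF that(2) stacked_derivative(1)[OF that(3)]])
      fix r
      assume r: "r \<in> {t..u}"
      have "norm (- L (XH m) - ZZ m r - G (XX m r)) \<le> norm (L (XH m)) + norm (ZZ m r) + norm (G (XX m r))"
        using norm_triangle_ineq4[of "- L (XH m) - ZZ m r" "G (XX m r)"] norm_triangle_ineq4[of "- L (XH m)" "ZZ m r"]
        by simp
      then show "norm (- L (XH m) - ZZ m r - G (XX m r)) \<le> C"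
        using LX[of m] G_le[OF in_range[OF r]] B(2)[OF in_range[OF r]] unfolding C_def by linarith
    qed
    show "norm (ZZ m u - ZZ m t) \<le> C * (u - t)"
    proof (rule vector_derivative_bound_imp_lipschitz[OF that(2) stacked_derivative(2)[OF that(3)]])
      show "norm (- L (YH m)) \<le> C"
        using LY[of m] B(1) \<Gamma> unfolding C_def norm_minus_cancel by linarith
    qed
  qed
  have "norm (XX m u - XX m t) \<le> C * (u - t) \<and> norm (ZZ m u - ZZ m t) \<le> C * (u - t)"
    if "0 \<le> t" "t \<le> u" "ereal u \<le> s (Suc m)" for m t u
    using that
  proof (induction m arbitrary: t u)
    case 0
    then show ?case
      by (intro piece) (auto simp: s_0)
  next
    case (Suc m)
    have early: "norm (XX (Suc m) v - XX (Suc m) t) \<le> C * (v - t) \<and> norm (ZZ (Suc m) v - ZZ (Suc m) t) \<le> C * (v - t)"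
      if "t \<le> v" "ereal v \<le> s (Suc m)" for v
    proof -
      have "ereal t \<le> s (Suc m)"
        using that order_trans[of "ereal t" "ereal v"] by simp
      then show ?thesis
        using Suc.IH[OF Suc.prems(1) that] agree_stacked[of v m] agree_stacked[of t m] that Suc.prems(1) by simp
    qed
    consider "ereal u \<le> s (Suc m)" | "s (Suc m) \<le> ereal t"
      | a where "s (Suc m) = ereal a" "0 \<le> a" "t \<le> a" "a \<le> u"
      by (cases rule: s_finite_cases[of "Suc m"]) force+
    then show ?case
    proof cases
      case 1
      then show ?thesis
        using early Suc.prems by blast
    next
      case 2
      then show ?thesis
        using piece Suc.prems by blast
    next
      case 3
      have "norm (XX (Suc m) u - XX (Suc m) a) \<le> C * (u - a) \<and> norm (ZZ (Suc m) u - ZZ (Suc m) a) \<le> C * (u - a)"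
        using 3 Suc.prems by (intro piece) auto
      moreover have "norm (XX (Suc m) a - XX (Suc m) t) \<le> C * (a - t) \<and> norm (ZZ (Suc m) a - ZZ (Suc m) t) \<le> C * (a - t)"
        using 3 by (intro early) auto
      moreover have "C * (u - a) + C * (a - t) = C * (u - t)"
        by (simp add: algebra_simps)
      ultimately show ?thesis
        using norm_triangle_ineq[of "XX (Suc m) u - XX (Suc m) a" "XX (Suc m) a - XX (Suc m) t"]
          norm_triangle_ineq[of "ZZ (Suc m) u - ZZ (Suc m) a" "ZZ (Suc m) a - ZZ (Suc m) t"] by simp
    qed
  qed
  with C show thesis
    using that by blast
qed

text \<open>The sum of last broadcast times is the progress measure, insensitive to coinciding
  events: no summand decreases, and a triggering agent must have drifted from its own last broadcast
  by at least |\<xi>|, which takes a minimal time. \<delta> depends on \<open>R\<close> because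
  |\<xi>| decays.\<close>

lemma dwell_time:
  obtains \<delta> where "0 < \<delta>"
    and "\<And>m. s (Suc m) \<le> ereal R \<Longrightarrow> (\<Sum>i\<in>UNIV. \<tau> m i) + \<delta> \<le> (\<Sum>i\<in>UNIV. \<tau> (Suc m) i)"
proof -
  obtain C where C: "0 < C" "\<And>m t u. 0 \<le> t \<Longrightarrow> t \<le> u \<Longrightarrow> ereal u \<le> s (Suc m) \<Longrightarrow>
    norm (XX m u - XX m t) \<le> C * (u - t) \<and> norm (ZZ m u - ZZ m t) \<le> C * (u - t)"
    using state_lipschitz by blast
  define \<mu> where "\<mu> = Min (range (\<lambda>i. \<bar>\<xi> i 0\<bar>))"
  have \<mu>: "0 < \<mu>" "\<And>i. \<mu> \<le> \<bar>\<xi> i 0\<bar>"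
    using \<xi>0 by (auto simp: \<mu>_def)
  \<comment> \<open>Lipschitz constant for the three components of the error: x and z contribute C
    each, the gradient \<beta> C.\<close>
  define K where "K = (2 + \<beta>) * C"
  have K: "0 < K"
    using C(1) \<beta>_pos by (simp add: K_def)
  define \<delta> where "\<delta> = \<mu> * exp (- nu * R) / K"
  show thesis
  proof (rule that[of \<delta>])
    show "0 < \<delta>"
      using \<mu>(1) K by (simp add: \<delta>_def)
    fix m
    assume R: "s (Suc m) \<le> ereal R"
    then obtain r where r: "s (Suc m) = ereal r" "0 \<le> r"
      by (cases rule: s_finite_cases[of "Suc m"]) auto
    have rR: "r \<le> R"
      using R r by simp
    have mono: "\<tau> m i \<le> \<tau> (Suc m) i" and \<tau>r: "\<tau> m i \<le> r" for i
      using \<tau>_le_s[of m i] s_le_Suc[of m] order_trans[of "ereal (\<tau> m i)" "s m" "ereal r"] r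
      by (auto simp: \<tau>_Suc)
    let ?nt = "\<lambda>i. next_trigger f lam (X m) (Z m) \<xi> i (\<tau> m i)"
    \<comment> \<open>With finitely many agents the infimum is a minimum, so some agent triggers at
      this event.\<close>
    have "Inf (range ?nt) \<in> range ?nt"
      by (subst Min_Inf[symmetric]) (auto intro!: Min_in)
    then obtain i where i: "?nt i = ereal r"
      using r(1) unfolding s_Suc by auto
    then have \<tau>i: "\<tau> (Suc m) i = r"
      using r by (simp add: \<tau>_Suc)
    have "\<bar>\<xi> i r\<bar> \<le> norm (err m i r)"
      using excess_nonneg_at_trigger[OF i] mult_nonneg_nonneg[OF less_imp_le[OF lam(1)] norm_ge_zero[of "Z m i r + grad (f i) (X m i r)"]]
      unfolding excess_def by linarith
    also have "\<dots> \<le> norm (X m i r - X m i (\<tau> m i)) + (norm (Z m i r - Z m i (\<tau> m i))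
        + norm (grad (f i) (X m i r) - grad (f i) (X m i (\<tau> m i))))"
      unfolding err_def by (meson norm_Pair_le add_left_mono order_trans)
    also have "\<dots> \<le> C * (r - \<tau> m i) + (C * (r - \<tau> m i) + \<beta> * (C * (r - \<tau> m i)))"
    proof -
      note lip = C(2)[OF \<tau>_nonneg[of m i] \<tau>r[of i], of m]
      have x: "norm (X m i r - X m i (\<tau> m i)) \<le> C * (r - \<tau> m i)"
        using lip Finite_Cartesian_Product.norm_nth_le[of "XX m r - XX m (\<tau> m i)" i] r(1) by (simp add: XX_def)
      moreover have "norm (Z m i r - Z m i (\<tau> m i)) \<le> C * (r - \<tau> m i)"
        using lip Finite_Cartesian_Product.norm_nth_le[of "ZZ m r - ZZ m (\<tau> m i)" i] r(1) by (simp add: ZZ_def)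
      moreover have "norm (grad (f i) (X m i r) - grad (f i) (X m i (\<tau> m i))) \<le> \<beta> * (C * (r - \<tau> m i))"
        using order_trans[OF norm_grad_diff_le mult_left_mono[OF x]] \<beta>_pos by simp
      ultimately show ?thesis
        by linarith
    qed
    also have "\<dots> = K * (r - \<tau> m i)"
      by (simp add: K_def algebra_simps)
    finally have "\<bar>\<xi> i r\<bar> \<le> K * (r - \<tau> m i)" .
    moreover have "\<mu> * exp (- nu * R) \<le> \<bar>\<xi> i r\<bar>"
      unfolding abs_\<xi>_eq[OF r(2)] using \<mu> rR nu c_pos by (intro mult_mono) auto
    ultimately have "\<delta> \<le> \<tau> (Suc m) i - \<tau> m i"
      using K by (simp add: \<delta>_def \<tau>i pos_divide_le_eq mult.commute)
    also have "\<dots> \<le> (\<Sum>i\<in>UNIV. \<tau> (Suc m) i - \<tau> m i)"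
      using mono by (intro member_le_sum) auto
    finally show "(\<Sum>i\<in>UNIV. \<tau> m i) + \<delta> \<le> (\<Sum>i\<in>UNIV. \<tau> (Suc m) i)"
      by (simp add: sum_subtractf)
  qed
qed

text \<open>Otherwise the sum of last broadcast times would grow by \<delta> at every event while
  staying below N R.\<close>

lemma events_unbounded: "\<exists>m. ereal R < s m"
proof (rule ccontr)
  assume "\<nexists>m. ereal R < s m"
  then have R: "s m \<le> ereal R" for m
    by (simp add: not_less)
  obtain \<delta> where \<delta>: "0 < \<delta>" "\<And>m. (\<Sum>i\<in>UNIV. \<tau> m i) + \<delta> \<le> (\<Sum>i\<in>UNIV. \<tau> (Suc m) i)"
    using dwell_time[of R] R by metis
  have "real m * \<delta> \<le> (\<Sum>i\<in>UNIV. \<tau> m i)" for m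
  proof (induction m)
    case (Suc m)
    then show ?case
      using \<delta>(2)[of m] by (simp add: algebra_simps)
  qed (simp add: \<tau>_0)
  moreover have "\<tau> m i \<le> R" for m i
    using \<tau>_le_s[of m i] R[of m] order_trans by (metis ereal_less_eq(3))
  then have "(\<Sum>i\<in>UNIV. \<tau> m i) \<le> real CARD('n) * R" for m
    using sum_mono[of UNIV "\<tau> m" "\<lambda>_. R"] by simp
  ultimately have "real m * \<delta> \<le> real CARD('n) * R" for m
    using order_trans by blast
  then show False
    using reals_Archimedean3[OF \<delta>(1)] by (metis linorder_not_le)
qed

lemma covers_time:
  obtains m where "ereal t \<le> s (Suc m)"
  using events_unbounded[of t] s_le_Suc by (meson less_imp_le order_trans)

lemma error_decay:
  assumes "0 \<le> t" "ereal t \<le> s (Suc m)"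
  shows "norm (X m i t - xstar) \<le> 2 * sqrt level * exp (- (c / 2) * t)"
proof -
  have "(norm (XX m t - xbar))\<^sup>2 \<le> 4 * (level * exp (- c * t))"
    using norm_error_le[of "XX m t" "ZZ m t"] V_decay[OF assms] by linarith
  \<comment> \<open>Taking the square root halves the rate, whence c / 2.\<close>
  also have "\<dots> = (2 * sqrt level * exp (- (c / 2) * t))\<^sup>2"
    using level_nonneg by (simp add: power_mult_distrib flip: exp_double)
  finally have "norm (XX m t - xbar) \<le> 2 * sqrt level * exp (- (c / 2) * t)"
    by (rule power2_le_imp_le) (simp add: level_nonneg)
  moreover have "norm (X m i t - xstar) \<le> norm (XX m t - xbar)"
    using Finite_Cartesian_Product.norm_nth_le[of "XX m t - xbar" i] by (simp add: XX_def xbar_def)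
  ultimately show ?thesis
    by linarith
qed

text \<open>Each positive triggering time is an event time, and only finitely many events occur up
  to a bound of the sequence; a strictly increasing sequence has infinite range.\<close>

lemma not_zeno: "\<not> zeno (range (\<lambda>m. \<tau> m i))"
proof
  assume "zeno (range (\<lambda>m. \<tau> m i))"
  then obtain t :: "nat \<Rightarrow> real" where t: "strict_mono t" "range t = range (\<lambda>m. \<tau> m i)" "convergent t"
    unfolding zeno_def by blast
  obtain K where K: "\<And>n. t n \<le> K"
    using convergent_imp_Bseq[OF t(3)] unfolding Bseq_def by (metis abs_le_D1 real_norm_def)
  obtain M where M: "ereal K < s M"
    using events_unbounded by blast
  have cases: "\<tau> m i = 0 \<or> (\<exists>k\<le>m. 0 < k \<and> ereal (\<tau> m i) = s k)" for m
  proof (induction m)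
    case (Suc m)
    show ?case
    proof (cases "\<tau> (Suc m) i = \<tau> m i")
      case True
      then show ?thesis
        using Suc le_SucI by metis
    next
      case False
      then have "s (Suc m) < \<infinity>" "\<tau> (Suc m) i = real_of_ereal (s (Suc m))"
        unfolding \<tau>_Suc by (auto split: if_splits)
      then have "ereal (\<tau> (Suc m) i) = s (Suc m)"
        using s_nonneg[of "Suc m"] by (cases "s (Suc m)") simp_all
      then show ?thesis
        by blast
    qed
  qed (simp add: \<tau>_0)
  have "range t \<subseteq> insert 0 ((\<lambda>k. real_of_ereal (s k)) ` {..M})"
  proof
    fix y
    assume "y \<in> range t"
    then have y: "y \<le> K" and "y \<in> range (\<lambda>m. \<tau> m i)"
      using K unfolding t(2)[symmetric] by blast+
    then obtain m where m: "y = \<tau> m i"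
      by blast
    have "y \<in> (\<lambda>k. real_of_ereal (s k)) ` {..M}" if "ereal y = s k" for k
    proof -
      have "s k < s M"
        using y M that by (metis ereal_less_eq(3) le_less_trans)
      then have "k \<le> M"
        using incseq_s by (metis incseqD leD nle_le)
      moreover have "y = real_of_ereal (s k)"
        using that by (metis real_of_ereal.simps(1))
      ultimately show ?thesis
        by blast
    qed
    then show "y \<in> insert 0 ((\<lambda>k. real_of_ereal (s k)) ` {..M})"
      using cases[of m] m by blast
  qed
  then have "finite (range t)"
    by (rule finite_subset) simp
  then show False
    using strict_mono_imp_inj_on[OF t(1)] by (simp add: finite_image_iff)
qed

end

theorem mainTheorem3:
  fixes f :: "'n::finite \<Rightarrow> real^'d \<Rightarrow> real"
    and E :: "('n \<times> 'n) set" and W :: "real^'n^'n"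
    and \<alpha> \<beta> :: real and xstar :: "real^'d"
    and x0 z0 :: "'n \<Rightarrow> real^'d" and \<xi>0 :: "'n \<Rightarrow> real"
  assumes "\<alpha> > 0"
    and "\<And>i x. f i differentiable at x"
    and "\<And>i. strongly_convex \<alpha> (f i)"
    and "\<beta> > 0"
    and "\<And>i. \<beta>-lipschitz_on UNIV (grad (f i))"
    and "sym E" and "\<And>i. (i, i) \<in> E" and "connected_graph E"
    and "weighted_adjacency E W"
    and "\<And>y. y \<noteq> xstar \<Longrightarrow> (\<Sum>i\<in>UNIV. f i xstar) < (\<Sum>i\<in>UNIV. f i y)"
    and "(\<Sum>i\<in>UNIV. z0 i) = 0"
    and "\<And>i. \<xi>0 i \<noteq> 0"
  shows "\<exists>lamstar nustar a5 a6 :: real. lamstar > 0 \<and> nustar > 0 \<and> a5 > 0 \<and> a6 > 0 \<and>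
    (\<forall>lam nu x z \<xi> T.
       0 < lam \<and> lam < lamstar \<and> nu > nustar \<and>
       atgt_execution E W f lam nu x z \<xi> T \<and>
       (\<forall>i. x i 0 = x0 i \<and> z i 0 = z0 i \<and> \<xi> i 0 = \<xi>0 i) \<longrightarrow>
       (\<forall>t\<ge>0. \<forall>i. norm (x i t - xstar) \<le> a5 * exp (- a6 * t)) \<and>
       (\<forall>i. \<not> zeno (T i)))"
proof -
  have "(\<Sum>i\<in>UNIV. grad (f i) xstar) = 0"
  proof (rule sum_grad_eq_0_at_minimum[OF assms(2)])
    show "(\<Sum>i\<in>UNIV. f i xstar) \<le> (\<Sum>i\<in>UNIV. f i y)" for y
      using assms(10)[of y] by (cases "y = xstar") auto
  qed
  then interpret tracking_network f E W \<alpha> \<beta> xstar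
    using assms by unfold_locales auto
  obtain V c D lamstar where "tracking_lyapunov f E W \<alpha> \<beta> xstar V c D lamstar"
    by (rule tracking_lyapunov_exists)
  then interpret tracking_lyapunov f E W \<alpha> \<beta> xstar V c D lamstar .
  define lev where "lev = V (\<chi> i. x0 i) (\<chi> i. z0 i) + D * (L2_set (\<lambda>i. \<bar>\<xi>0 i\<bar>) UNIV)\<^sup>2 / c"
  \<comment> \<open>Fixed before any execution is considered; the absolute value and the added 1
    make it positive outright.\<close>
  define a5 where "a5 = 2 * sqrt \<bar>lev\<bar> + 1"
  have "(\<forall>t\<ge>0. \<forall>i. norm (x i t - xstar) \<le> a5 * exp (- (c / 2) * t)) \<and> (\<forall>i. \<not> zeno (T i))"
    if par: "0 < lam" "lam < lamstar" "c < nu" and exec: "atgt_execution E W f lam nu x z \<xi> T"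
      and init: "\<And>i. x i 0 = x0 i \<and> z i 0 = z0 i \<and> \<xi> i 0 = \<xi>0 i" for lam nu x z \<xi> T
  proof -
    obtain s :: "nat \<Rightarrow> ereal" and \<tau> X Z where
      ode: "\<And>i t. 0 \<le> t \<Longrightarrow> (\<xi> i has_real_derivative - nu * \<xi> i t) (at t within {0..})" and
      s0: "s 0 = 0" and \<tau>0: "\<And>i. \<tau> 0 i = 0" and
      held: "\<And>m. held_dynamics E W f (\<tau> m) (X m) (Z m) {t. s m \<le> ereal t}" and
      s_Suc: "\<And>m. s (Suc m) = (INF i. next_trigger f lam (X m) (Z m) \<xi> i (\<tau> m i))" and
      \<tau>_Suc: "\<And>m i. \<tau> (Suc m) i =
           (if s (Suc m) < \<infinity> \<and> next_trigger f lam (X m) (Z m) \<xi> i (\<tau> m i) = s (Suc m)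
            then real_of_ereal (s (Suc m)) else \<tau> m i)" and
      agree: "\<And>m i t. 0 \<le> t \<Longrightarrow> ereal t \<le> s (Suc m) \<Longrightarrow>
           X (Suc m) i t = X m i t \<and> Z (Suc m) i t = Z m i t" and
      xz: "\<And>m i t. 0 \<le> t \<Longrightarrow> ereal t \<le> s (Suc m) \<Longrightarrow> x i t = X m i t \<and> z i t = Z m i t" and
      T: "\<And>i. T i = range (\<lambda>m. \<tau> m i)"
      using exec unfolding atgt_execution_def by blast
    have "0 \<le> next_trigger f lam (X 0) (Z 0) \<xi> i (\<tau> 0 i)" for i
      unfolding next_trigger_def by (intro Inf_greatest) (auto simp: \<tau>0)
    \<comment> \<open>Puts time 0 in the range where x and z agree with the trajectory of index 0,
      transferring the initial data.\<close>
    then have "ereal 0 \<le> s (Suc 0)"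
      unfolding s_Suc zero_ereal_def[symmetric] by (intro INF_greatest)
    then have init': "X 0 i 0 = x0 i" "Z 0 i 0 = z0 i" for i
      using xz[of 0 0 i] init[of i] by simp_all
    interpret triggered_execution f E W \<alpha> \<beta> xstar V c D lamstar lam nu \<xi> s \<tau> X Z
    proof unfold_locales
      show "\<xi> i 0 \<noteq> 0" for i
        using init assms(12) by simp
      show "(\<Sum>i\<in>UNIV. Z 0 i 0) = 0"
        using init' assms(11) by simp
    qed (fact par less_imp_le[OF par(3)] ode s0 \<tau>0 held s_Suc \<tau>_Suc agree)+
    have level: "level = lev"
      using init init' by (simp add: level_def lev_def \<xi>_norm_def XX_def ZZ_def)
    have "norm (x i t - xstar) \<le> a5 * exp (- (c / 2) * t)" if "0 \<le> t" for i t
    proof -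
      obtain m where m: "ereal t \<le> s (Suc m)"
        using covers_time by blast
      have "norm (x i t - xstar) \<le> 2 * sqrt lev * exp (- (c / 2) * t)"
        using error_decay[OF that m, of i] xz[OF that m, of i] by (simp add: level)
      also have "\<dots> \<le> a5 * exp (- (c / 2) * t)"
        by (intro mult_right_mono) (simp_all add: a5_def add_increasing2)
      finally show ?thesis .
    qed
    then show ?thesis
      using not_zeno by (simp add: T)
  qed
  moreover have "0 < a5"
    by (simp add: a5_def add_nonneg_pos)
  ultimately show ?thesis
    \<comment> \<open>The rate c serves as the threshold for nu and c / 2 as the exponent.\<close>
    using lamstar_pos c_pos by (intro exI[of _ lamstar] exI[of _ c] exI[of _ a5] exI[of _ "c / 2"]) auto
qed

end
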